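(* For all integers $k\ge1$ and $n\ge0$, $$e_6(5^kn+\delta_{5,k})\equiv0\pmod{5^{2k}}.$$
   Context: $q=e^{2\pi i\tau}$, $(q;q)_\infty=\prod_{n\ge1}(1-q^n)$, $E_6(\tau)=1-504\sum_{n\ge1}\sigma_5(n)q^n$ with $\sigma_5(n)=\sum_{d\mid n}d^5$. The numbers $e_6(n)$ are defined by $\sum_{n\ge0}e_6(n)q^n=E_6(\tau)/(q;q)_\infty$. For a prime $\ell\ge5$ and $k\ge1$, $\delta_{\ell,k}$ is the integer with $0<\delta_{\ell,k}<\ell^k$ and $24\delta_{\ell,k}\equiv1\pmod{\ell^k}$. *)

theory Defs
  imports
    "HOL-Analysis.Analysis"
    "HOL-Number_Theory.Cong"
begin

text \<open>
  The nome \<open>q = exp (2 * pi * \<i> * \<tau>)\<close> is rendered by the formal variable \<open>fps_X\<close>: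
  all $q$-series are formal power series with integer coefficients. Infinite products are
  taken in the $X$-adic topology of the type \<open>fps\<close>.
\<close>

definition divisor_sigma :: "nat \<Rightarrow> nat \<Rightarrow> nat" where
  "divisor_sigma k n = (\<Sum>d | d dvd n. d ^ k)"

text \<open>The constant term is split off because every number divides \<open>0\<close>.\<close>

definition E6_fps :: "int fps" where
  "E6_fps = Abs_fps (\<lambda>n. if n = 0 then 1 else - 504 * int (divisor_sigma 5 n))"

definition euler_product :: "int fps" where
  "euler_product = (\<Prod>n. 1 - fps_X ^ Suc n)"

text \<open>
  The quotient \<open>E6 / (q;q)\<close> is formed in the ring of integer power series, where division is not
  available as an operation; \<open>fps_right_inverse f y\<close> is the inverse of \<open>f\<close> provided that
  \<open>y\<close> is the inverse of its constant term, which is \<open>1\<close> here.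
\<close>

definition e6_fps :: "int fps" where
  "e6_fps = E6_fps * fps_right_inverse euler_product 1"

definition e6 :: "nat \<Rightarrow> int" where
  "e6 n = fps_nth e6_fps n"

definition delta :: "nat \<Rightarrow> nat \<Rightarrow> nat" where
  "delta l k = (THE d. 0 < d \<and> d < l ^ k \<and> [24 * d = 1] (mod l ^ k))"

lemma fps_nth_euler_partial_product:
  assumes "n \<le> m"
  shows "fps_nth (\<Prod>i\<le>m. 1 - fps_X ^ Suc i :: int fps) n
       = fps_nth (\<Prod>i\<le>n. 1 - fps_X ^ Suc i) n"
  using assms
proof (induction m rule: dec_induct)
  case base
  then show ?case by simp
next
  case (step m)
  have "fps_nth (\<Prod>i\<le>Suc m. 1 - fps_X ^ Suc i :: int fps) n
      = fps_nth ((\<Prod>i\<le>m. 1 - fps_X ^ Suc i) * (1 - fps_X ^ Suc (Suc m))) n"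
    by (simp only: prod.atMost_Suc)
  also have "\<dots> = fps_nth (\<Prod>i\<le>m. 1 - fps_X ^ Suc i) n"
    using step.hyps
    by (simp only: right_diff_distrib fps_sub_nth fps_X_power_mult_right_nth) simp
  finally show ?case
    using step.IH by simp
qed

lemma euler_product_has_prod_aux:
  defines "P \<equiv> Abs_fps (\<lambda>n. fps_nth (\<Prod>i\<le>n. 1 - fps_X ^ Suc i :: int fps) n)"
  shows "(\<lambda>n. 1 - fps_X ^ Suc n) has_prod P"
proof -
  have "(\<lambda>m. \<Prod>i\<le>m. 1 - fps_X ^ Suc i) \<longlonglongrightarrow> P"
  proof (rule tendsto_fpsI)
    fix n
    show "\<forall>\<^sub>F m in sequentially. fps_nth (\<Prod>i\<le>m. 1 - fps_X ^ Suc i) n = fps_nth P n"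
      by (rule eventually_sequentiallyI[of n])
         (simp only: P_def fps_nth_Abs_fps, rule fps_nth_euler_partial_product)
  qed
  moreover have "fps_nth P 0 = 1"
    by (simp add: P_def)
  hence "P \<noteq> 0" by auto
  ultimately show ?thesis
    by (simp add: raw_has_prod_def has_prod_def)
qed

lemma euler_product_has_prod: "(\<lambda>n. 1 - fps_X ^ Suc n) has_prod euler_product"
  unfolding euler_product_def
  using euler_product_has_prod_aux
  by (subst has_prod_unique[OF euler_product_has_prod_aux, symmetric])

lemma fps_nth_euler_product:
  "fps_nth euler_product n = fps_nth (\<Prod>i\<le>n. 1 - fps_X ^ Suc i) n"
proof -
  have "euler_product = Abs_fps (\<lambda>n. fps_nth (\<Prod>i\<le>n. 1 - fps_X ^ Suc i) n)"
    using euler_product_has_prod euler_product_has_prod_aux by (rule has_prod_unique2)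
  from arg_cong[OF this, of "\<lambda>f. fps_nth f n"] show ?thesis
    by (simp only: fps_nth_Abs_fps)
qed

lemma e6_fps_mult_euler_product: "e6_fps * euler_product = E6_fps"
proof -
  have "euler_product * fps_right_inverse euler_product 1 = 1"
    by (rule fps_right_inverse) (simp add: fps_nth_euler_product)
  hence "fps_right_inverse euler_product 1 * euler_product = 1"
    by (simp only: mult.commute)
  thus ?thesis by (simp only: e6_fps_def mult.assoc mult_1_right)
qed

lemma delta_exists_unique:
  assumes "prime l" "5 \<le> l" "1 \<le> k"
  shows "\<exists>!d::nat. 0 < d \<and> d < l ^ k \<and> [24 * d = 1] (mod l ^ k)"
proof -
  have "\<not> l dvd 24"
  proof
    assume "l dvd 24"
    also have "(24 :: nat) = 2 ^ 3 * 3" by simp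
    finally have "l dvd 2 ^ 3 \<or> l dvd 3"
      using \<open>prime l\<close> by (simp only: prime_dvd_mult_iff)
    hence "l dvd 2 \<or> l dvd 3"
      using \<open>prime l\<close> prime_dvd_power by blast
    with \<open>5 \<le> l\<close> show False
      by (auto dest: dvd_imp_le)
  qed
  with \<open>prime l\<close> have cop: "coprime 24 (l ^ k)"
    by (simp only: coprime_commute[of 24] coprime_power_left_iff prime_imp_coprime simp_thms)
  have gt1: "1 < l ^ k"
    using assms by (intro one_less_power) auto
  from cop obtain x where x: "[24 * x = 1] (mod l ^ k)"
    using cong_solve_coprime_nat[OF cop] by auto
  have ex: "[24 * (x mod l ^ k) = 1] (mod l ^ k)"
    using x unfolding cong_def by (simp only: mod_mult_right_eq)
  moreover have "x mod l ^ k \<noteq> 0"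
  proof
    assume "x mod l ^ k = 0"
    with ex have "1 mod l ^ k = 0" by (simp add: cong_def)
    with gt1 show False by (simp only: mod_less)
  qed
  moreover have "x mod l ^ k < l ^ k"
    by (rule mod_less_divisor) (use gt1 in linarith)
  ultimately have "\<exists>d. 0 < d \<and> d < l ^ k \<and> [24 * d = 1] (mod l ^ k)"
    by blast
  moreover have "d = e" if "d < l ^ k" "e < l ^ k"
    "[24 * d = 1] (mod l ^ k)" "[24 * e = 1] (mod l ^ k)" for d e
  proof -
    have "[24 * d = 24 * e] (mod l ^ k)"
      using that cong_sym cong_trans by blast
    hence "[d = e] (mod l ^ k)"
      using cop cong_mult_lcancel_nat by blast
    with that show "d = e"
      by (simp add: cong_less_modulus_unique_nat)
  qed
  ultimately show ?thesis by blast
qed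

end

theory Submission
  imports Defs
begin

unbundle no vec_syntax
unbundle fps_syntax

text \<open>
  Write \<open>E\<close> for Euler's product, \<open>U\<close> for the operator \<open>\<Sum> c(n) q^n \<mapsto> \<Sum> c(5n) q^n\<close>, and put
  \<open>z = q E(q^25) / E(q)\<close>, \<open>t = q E(q^5)^6 / E(q)^6\<close>, \<open>a = E(q)^5 / E(q^5)\<close> and
  \<open>S = q t' / t = (5 E2(q^5) - E2(q)) / 4\<close>.

  The 5-dissection of \<open>E\<close> gives the modular equation
  \<open>z^5 = t(q^5) (1 + 5z + 15z^2 + 25z^3 + 25z^4)\<close>. Differentiating it shows that both
  \<open>S^2 - a^2 (1 + 22t + 125t^2)\<close> and \<open>E4 - a^2 (1 + 250t + 3125t^2)\<close> satisfy a relation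
  \<open>u f = v f(q^5)\<close>, which forces \<open>f = 0\<close>. With Ramanujan's differential equations this yields
  \<open>E6 = S a^2 (1 - 500t - 15625t^2)\<close>.

  The modular equation also determines \<open>U(S a^2 z^s t^i)\<close> as \<open>S a^2\<close> times a polynomial in \<open>t\<close>
  whose coefficients satisfy a linear recurrence. The generating function of
  \<open>e6(5^k n + delta)\<close>, times \<open>q E(q^5)\<close> or \<open>q E(q)\<close>, arises from \<open>E6\<close> by \<open>k\<close> such steps with
  \<open>s = 1, 0, 1, 0, \<dots>\<close>, and each step gains a factor \<open>5^2\<close>.
\<close>

text \<open>The prefix \<open>S a^2\<close> matches weights: \<open>S\<close> and \<open>a\<close>
  have weight 2, \<open>E6\<close> has weight 6 and \<open>t\<close> has weight 0. The factor
  \<open>S\<close> also makes \<open>U\<close> gain a 5. Directly, \<open>U\<close> is evaluated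
  only on \<open>z^-1\<close> to \<open>z^-4\<close>, where \<open>1/z = E(q) / (q E(q^25))\<close>
  has a numerator with just three residue classes of exponents modulo 5. Because
  \<open>S = 6 q z'/z - 5 S(q^5)\<close>, multiplying such a power by \<open>S\<close> amounts to
  differentiating it, up to series in \<open>q^5\<close>, and \<open>U\<close> turns
  \<open>q d/dq\<close> into \<open>5 q d/dq\<close>. The obstacle is the constant term in
  \<open>t\<close>: \<open>U(S a^2)\<close> is \<open>S a^2\<close> modulo 5, so nothing is gained
  there. The factor \<open>z\<close> in the first step removes this term for good. On the other
  terms the gain depends on the power of \<open>t\<close>, so the induction carries the exponents
  \<open>floor((5j + c) / 2)\<close> and raises \<open>c\<close> by 4 in each step; for
  \<open>t^1\<close> with a factor \<open>z\<close> this succeeds only because of the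
  rounding.\<close>

section \<open>Dilation, the operator U and the derivation q d/dq\<close>

definition dil :: "'a::comm_ring_1 fps \<Rightarrow> 'a fps" where
  "dil f = Abs_fps (\<lambda>n. if 5 dvd n then f $ (n div 5) else 0)"

definition hecke_U :: "'a::comm_ring_1 fps \<Rightarrow> 'a fps" where
  "hecke_U f = Abs_fps (\<lambda>n. f $ (5 * n))"

lemma dil_nth: "dil f $ n = (if 5 dvd n then f $ (n div 5) else 0)"
  by (simp add: dil_def)

lemma dil_nth_0 [simp]: "dil f $ 0 = f $ 0"
  by (simp add: dil_nth)

lemma hecke_U_nth [simp]: "hecke_U f $ n = f $ (5 * n)"
  by (simp add: hecke_U_def)

lemma dil_1 [simp]: "dil 1 = 1"
  and dil_add: "dil (f + g) = dil f + dil g"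
  and dil_diff: "dil (f - g) = dil f - dil g"
  and dil_uminus: "dil (- f) = - dil f"
  by (auto simp: fps_eq_iff dil_nth elim!: dvdE)

lemma dil_of_int [simp]: "dil (of_int c) = of_int c"
  unfolding fps_of_int [symmetric] by (auto simp: fps_eq_iff dil_nth elim!: dvdE)

lemma dil_numeral [simp]: "dil (numeral c) = numeral c"
  using dil_of_int[of "numeral c"] by simp

lemma sum_dil_mult:
  "(\<Sum>i=0..5*n. dil f $ i * g i) = (\<Sum>i=0..n. f $ i * g (5 * i))"
proof -
  have "(\<Sum>i=0..5*n. dil f $ i * g i) = (\<Sum>i\<in>(*) 5 ` {0..n}. dil f $ i * g i)"
  proof (rule sum.mono_neutral_right)
    show "\<forall>i\<in>{0..5*n} - (*) 5 ` {0..n}. dil f $ i * g i = 0"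
      by (auto simp: dil_nth image_iff elim!: dvdE)
  qed auto
  also have "\<dots> = (\<Sum>i=0..n. f $ i * g (5 * i))"
    by (subst sum.reindex) (auto simp: inj_on_def dil_nth)
  finally show ?thesis .
qed

lemma dil_mult: "dil (f * g) = dil f * dil g"
proof (rule fps_ext)
  fix n
  show "dil (f * g) $ n = (dil f * dil g) $ n"
  proof (cases "5 dvd n")
    case True
    then obtain m where n: "n = 5 * m" by (elim dvdE)
    have "(dil f * dil g) $ n = (\<Sum>i=0..m. f $ i * dil g $ (5 * m - 5 * i))"
      unfolding n fps_mult_nth by (rule sum_dil_mult)
    also have "\<dots> = (\<Sum>i=0..m. f $ i * g $ (m - i))"
      by (intro sum.cong) (auto simp: dil_nth simp flip: diff_mult_distrib2)
    finally show ?thesis by (simp add: n dil_nth fps_mult_nth)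
  next
    case False
    have "(dil f * dil g) $ n = 0"
      unfolding fps_mult_nth
    proof (intro sum.neutral ballI)
      fix i assume i: "i \<in> {0..n}"
      show "dil f $ i * dil g $ (n - i) = 0"
      proof (cases "5 dvd i")
        case True
        with False i have "\<not> 5 dvd (n - i)" by (metis atLeastAtMost_iff dvd_diffD)
        then show ?thesis by (simp add: dil_nth)
      qed (simp add: dil_nth)
    qed
    with False show ?thesis by (simp add: dil_nth)
  qed
qed

lemma dil_power: "dil (f ^ k) = dil f ^ k"
  by (induction k) (simp_all add: dil_mult)

lemma dil_fps_X [simp]: "dil fps_X = fps_X ^ 5"
  by (auto simp: fps_eq_iff dil_nth fps_X_power_nth elim!: dvdE)

lemmas dil_simps = dil_add dil_diff dil_uminus dil_mult dil_power

lemma hecke_U_0 [simp]: "hecke_U 0 = 0"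
  and hecke_U_add: "hecke_U (f + g) = hecke_U f + hecke_U g"
  and hecke_U_diff: "hecke_U (f - g) = hecke_U f - hecke_U g"
  and hecke_U_uminus: "hecke_U (- f) = - hecke_U f"
  by (simp_all add: fps_eq_iff)

text \<open>This is the only product rule for U: it is linear over the series in q^5. Later
  evaluations first bring a factor into the form \<open>dil f\<close> so that it can leave
  U.\<close>

lemma hecke_U_dil_mult: "hecke_U (dil f * g) = f * hecke_U g"
  by (rule fps_ext) (simp add: fps_mult_nth sum_dil_mult diff_mult_distrib2)

lemma hecke_U_of_int_mult: "hecke_U (of_int c * f) = of_int c * hecke_U f"
  using hecke_U_dil_mult[of "of_int c" f] by simp

lemma hecke_U_numeral_mult: "hecke_U (numeral c * f) = numeral c * hecke_U f"
  using hecke_U_of_int_mult[of "numeral c" f] by simp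

text \<open>The derivation multiplies the coefficient at \<open>5 * n\<close> by
  \<open>5 * n\<close>. This is one source of the factor 5 in \<open>Bf_eq\<close>.\<close>

lemma hecke_U_fps_XD: "hecke_U (fps_XD f) = 5 * fps_XD (hecke_U f)"
  by (simp add: fps_eq_iff numeral_fps_const)

lemma fps_XD_dil: "fps_XD (dil f) = 5 * dil (fps_XD f)"
  by (auto simp: fps_eq_iff dil_nth numeral_fps_const elim!: dvdE)

lemma fps_XD_diff: "fps_XD (f - g) = fps_XD f - fps_XD (g :: 'a::comm_ring_1 fps)"
  and fps_XD_mult: "fps_XD (f * g) = fps_XD f * g + f * fps_XD (g :: 'a::comm_ring_1 fps)"
  by (simp_all add: fps_XD_def algebra_simps)

lemma fps_XD_1 [simp]: "fps_XD 1 = 0"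
  by (simp add: fps_XD_def)

lemma fps_XD_of_int [simp]: "fps_XD (of_int c) = 0"
  unfolding fps_of_int [symmetric] by (simp add: fps_XD_def)

lemma fps_XD_numeral [simp]: "fps_XD (numeral c) = 0"
  unfolding numeral_fps_const by (simp add: fps_XD_def)

lemma fps_XD_fps_X [simp]: "fps_XD fps_X = fps_X"
  by (simp add: fps_XD_def)

text \<open>Logarithmic derivatives are kept in the form \<open>f * u\<close>, so that no series has
  to be inverted.\<close>

lemma fps_XD_power_logarithmic:
  fixes f u :: "'a::comm_ring_1 fps"
  assumes "fps_XD f = f * u"
  shows "fps_XD (f ^ k) = f ^ k * (of_nat k * u)"
proof (induction k)
  case (Suc k)
  then show ?case by (simp add: fps_XD_mult assms) (simp add: algebra_simps)
qed simp

text \<open>If \<open>f\<close> had order \<open>m > 0\<close>, the two sides would have orders \<open>m\<close> and at least \<open>5 * m\<close>.\<close>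

lemma eq_0_if_mult_eq_mult_dil:
  fixes f u v :: "'a::idom fps"
  assumes eq: "u * f = v * dil f" and u: "u $ 0 \<noteq> 0" and f: "f $ 0 = 0"
  shows "f = 0"
proof -
  have "\<forall>i\<le>n. f $ i = 0" for n
  proof (induction n)
    case 0
    then show ?case using f by simp
  next
    case (Suc n)
    have "(u * f) $ Suc n = (\<Sum>i=0..Suc n. if i = 0 then u $ 0 * f $ Suc n else 0)"
      unfolding fps_mult_nth using Suc by (intro sum.cong) (auto simp: f)
    moreover have "(v * dil f) $ Suc n = 0"
      unfolding fps_mult_nth using Suc f by (intro sum.neutral) (auto simp: dil_nth)
    ultimately have "u $ 0 * f $ Suc n = 0" by (simp add: eq)
    with u have "f $ Suc n = 0" by simp
    with Suc show ?case by (auto simp: le_Suc_eq)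
  qed
  then show ?thesis by (auto simp: fps_eq_iff)
qed

section \<open>Residue classes of exponents, truncations and finite products\<close>

definition in_class :: "nat \<Rightarrow> 'a::comm_ring_1 fps \<Rightarrow> bool" where
  "in_class r f \<longleftrightarrow> (\<forall>n. f $ n \<noteq> 0 \<longrightarrow> [n = r] (mod 5))"

lemma in_class_mult:
  assumes "in_class r f" "in_class s g"
  shows "in_class (r + s) (f * g)"
  unfolding in_class_def
proof (intro allI impI)
  fix n assume "(f * g) $ n \<noteq> 0"
  then obtain i where i: "i \<in> {0..n}" "f $ i * g $ (n - i) \<noteq> 0"
    unfolding fps_mult_nth by (rule sum.not_neutral_contains_not_neutral)
  then have "f $ i \<noteq> 0" "g $ (n - i) \<noteq> 0" by auto
  then have "[i = r] (mod 5)" "[n - i = s] (mod 5)"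
    using assms unfolding in_class_def by auto
  then have "[i + (n - i) = r + s] (mod 5)" by (rule cong_add)
  with i show "[n = r + s] (mod 5)" by simp
qed

lemma in_class_1: "in_class 0 1"
  by (auto simp: in_class_def)

lemma in_class_power: "in_class r f \<Longrightarrow> in_class (k * r) (f ^ k)"
  by (induction k) (auto simp: in_class_1 in_class_mult)

lemma in_class_add: "in_class r f \<Longrightarrow> in_class r g \<Longrightarrow> in_class r (f + g)"
  by (force simp: in_class_def)

lemma hecke_U_eq_0: "in_class r f \<Longrightarrow> \<not> 5 dvd r \<Longrightarrow> hecke_U f = 0"
  by (auto simp: in_class_def fps_eq_iff cong_def dvd_eq_mod_eq_0)

text \<open>Congruence modulo q^N replaces limits: by \<open>fps_eq_if_fps_cong\<close> an identity
  of series follows from its truncations, where infinite products may be cut off.\<close>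

definition fps_cong :: "nat \<Rightarrow> 'a::comm_ring_1 fps \<Rightarrow> 'a fps \<Rightarrow> bool" where
  "fps_cong N f g \<longleftrightarrow> (\<forall>n<N. f $ n = g $ n)"

lemma fps_cong_refl [simp]: "fps_cong N f f"
  and fps_cong_sym: "fps_cong N f g \<Longrightarrow> fps_cong N g f"
  and fps_cong_trans [trans]: "fps_cong N f g \<Longrightarrow> fps_cong N g h \<Longrightarrow> fps_cong N f h"
  and fps_cong_mono: "fps_cong M f g \<Longrightarrow> N \<le> M \<Longrightarrow> fps_cong N f g"
  and fps_cong_add: "fps_cong N f g \<Longrightarrow> fps_cong N f' g' \<Longrightarrow> fps_cong N (f + f') (g + g')"
  by (auto simp: fps_cong_def)

lemma fps_cong_mult: "fps_cong N f g \<Longrightarrow> fps_cong N f' g' \<Longrightarrow> fps_cong N (f * f') (g * g')"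
  by (auto simp: fps_cong_def fps_mult_nth intro!: sum.cong)

lemma fps_cong_power: "fps_cong N f g \<Longrightarrow> fps_cong N (f ^ k) (g ^ k)"
  by (induction k) (auto intro: fps_cong_mult)

lemma fps_cong_sum:
  "(\<And>x. x \<in> A \<Longrightarrow> fps_cong N (f x) (g x)) \<Longrightarrow> fps_cong N (sum f A) (sum g A)"
  by (induction A rule: infinite_finite_induct) (auto intro: fps_cong_add)

lemma fps_cong_fps_X_power_mult:
  "fps_cong N f g \<Longrightarrow> fps_cong (N + k) (fps_X ^ k * f) (fps_X ^ k * g)"
  by (auto simp: fps_cong_def fps_X_power_mult_nth)

lemma fps_eq_if_fps_cong: "(\<And>N. fps_cong N f g) \<Longrightarrow> f = g"
  by (auto simp: fps_cong_def fps_eq_iff)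

lemma fps_cong_dil: "fps_cong N f g \<Longrightarrow> fps_cong N (dil f) (dil g)"
  by (auto simp: fps_cong_def dil_nth elim!: dvdE)

definition q_pochhammer :: "nat \<Rightarrow> 'a::comm_ring_1 fps" where
  "q_pochhammer n = (\<Prod>i\<in>{0<..n}. 1 - fps_X ^ i)"

lemma q_pochhammer_0 [simp]: "q_pochhammer 0 = 1"
  by (simp add: q_pochhammer_def)

lemma q_pochhammer_Suc: "q_pochhammer (Suc n) = q_pochhammer n * (1 - fps_X ^ Suc n)"
  by (simp add: q_pochhammer_def prod.nat_ivl_Suc' flip: atLeastSucAtMost_greaterThanAtMost
                del: power_Suc)

lemma q_pochhammer_nth_0 [simp]: "q_pochhammer n $ 0 = 1"
  by (induction n) (simp_all add: q_pochhammer_Suc)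

lemma q_pochhammer_nonzero [simp]: "q_pochhammer n \<noteq> (0 :: 'a::comm_ring_1 fps)"
  using q_pochhammer_nth_0 by (metis fps_zero_nth zero_neq_one)


lemma euler_product_cong': "N \<le> n + 1 \<Longrightarrow> fps_cong N euler_product (q_pochhammer n)"
proof -
  assume "N \<le> n + 1"
  have eq: "q_pochhammer n = (\<Prod>i<n. 1 - fps_X ^ Suc i :: int fps)"
    by (induction n) (simp_all add: q_pochhammer_Suc)
  have "euler_product $ k = (\<Prod>i<n. 1 - fps_X ^ Suc i :: int fps) $ k" if "k < n + 1" for k
  proof -
    have "euler_product $ k = (\<Prod>i\<le>n. 1 - fps_X ^ Suc i) $ k"
      using fps_nth_euler_partial_product[of k n] that by (simp add: fps_nth_euler_product)
    also have "\<dots> = ((\<Prod>i<n. 1 - fps_X ^ Suc i) * (1 - fps_X ^ Suc n)) $ k"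
      by (simp flip: lessThan_Suc_atMost del: power_Suc)
    also have "\<dots> = (\<Prod>i<n. 1 - fps_X ^ Suc i) $ k"
      using that by (simp only: right_diff_distrib fps_sub_nth fps_X_power_mult_right_nth) simp
    finally show ?thesis .
  qed
  with \<open>N \<le> n + 1\<close> show ?thesis by (simp add: fps_cong_def eq)
qed

lemma euler_product_nth_0 [simp]: "euler_product $ 0 = 1"
  by (simp add: fps_nth_euler_product)

lemma euler_product_nonzero [simp]: "euler_product \<noteq> 0"
  by (metis euler_product_nth_0 fps_zero_nth zero_neq_one)

subsection \<open>The pentagonal number theorem\<close>

primrec triangular :: "nat \<Rightarrow> nat" where
  "triangular 0 = 0"
| "triangular (Suc n) = triangular n + Suc n"

lemma double_triangular: "2 * triangular n = n * (n + 1)"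
  by (induction n) auto

lemma triangular_ge: "n \<le> triangular n"
  by (induction n) auto

definition pentagonal :: "int \<Rightarrow> nat" where
  "pentagonal s = nat (s * (3 * s - 1) div 2)"

lemma double_pentagonal: "2 * int (pentagonal s) = s * (3 * s - 1)"
proof -
  have "0 \<le> s * (3 * s - 1)"
    by (cases "s \<le> 0") (auto simp: mult_nonpos_nonpos)
  moreover have "2 dvd s * (3 * s - 1)" by auto
  ultimately show ?thesis by (simp add: pentagonal_def)
qed

lemma pentagonal_inj: "pentagonal s = pentagonal t \<Longrightarrow> s = t"
proof -
  assume "pentagonal s = pentagonal t"
  then have "s * (3 * s - 1) = t * (3 * t - 1)"
    by (metis double_pentagonal)
  then have "(s - t) * (3 * (s + t) - 1) = 0" by (simp add: algebra_simps)
  moreover have "3 * (s + t) - 1 \<noteq> 0" by presburger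
  ultimately show "s = t" by simp
qed

lemma pentagonal_of_nat: "pentagonal (int (Suc m)) = Suc m * m + triangular (Suc m)"
  and pentagonal_uminus_of_nat: "pentagonal (- int n) = n * n + triangular n"
proof -
  have "2 * int (pentagonal (int (Suc m))) = 2 * int (Suc m * m) + int (2 * triangular (Suc m))"
    unfolding double_pentagonal double_triangular by (simp add: algebra_simps)
  then show "pentagonal (int (Suc m)) = Suc m * m + triangular (Suc m)" by linarith
  have "2 * int (pentagonal (- int n)) = 2 * int (n * n) + int (2 * triangular n)"
    unfolding double_pentagonal double_triangular by (simp add: algebra_simps)
  then show "pentagonal (- int n) = n * n + triangular n" by linarith
qed

text \<open>
  Shanks' finite form: passing from \<open>m\<close> to \<open>m + 1\<close>, the summands of the left-hand side change by
  the telescoping differences \<open>g (Suc s) - g s\<close> below.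
\<close>

lemma shanks:
  "(\<Sum>s\<le>n. (-1) ^ s * (\<Prod>i\<in>{s<..n}. 1 - fps_X ^ i) * fps_X ^ (s * n + triangular s)) =
   (\<Sum>s\<in>{-int n..int n}. (-1) ^ nat \<bar>s\<bar> * fps_X ^ pentagonal s :: int fps)"
proof (induction n)
  case 0
  then show ?case by (simp add: pentagonal_def)
next
  case (Suc m)
  define a :: "nat \<Rightarrow> nat \<Rightarrow> int fps" where
    "a n s = (-1) ^ s * (\<Prod>i\<in>{s<..n}. 1 - fps_X ^ i) * fps_X ^ (s * n + triangular s)" for n s
  define g :: "nat \<Rightarrow> int fps" where
    "g s = (-1) ^ s * (\<Prod>i\<in>{s..m}. 1 - fps_X ^ i) * fps_X ^ (s * m + triangular s)" for s
  have step: "a (Suc m) s = a m s + (g (Suc s) - g s)" if "s \<le> m" for s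
  proof -
    define R :: "int fps" where "R = (\<Prod>i\<in>{s<..m}. 1 - fps_X ^ i)"
    define P :: "int fps" where "P = fps_X ^ (s * m + triangular s)"
    have 1: "{s<..Suc m} = insert (Suc m) {s<..m}" "{s..m} = insert s {s<..m}"
      "{Suc s..m} = {s<..m}"
      using that by auto
    have "fps_X ^ (s * Suc m + triangular s) = P * fps_X ^ s"
      "fps_X ^ (Suc s * m + triangular (Suc s)) = P * fps_X ^ s * fps_X ^ Suc m"
      unfolding P_def by (simp_all add: algebra_simps flip: power_add power_Suc)
    then have "a (Suc m) s = (-1) ^ s * ((1 - fps_X ^ Suc m) * R) * (P * fps_X ^ s)"
      "g (Suc s) = - ((-1) ^ s * R * (P * fps_X ^ s * fps_X ^ Suc m))"
      "g s = (-1) ^ s * ((1 - fps_X ^ s) * R) * P"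
      unfolding a_def g_def 1 by (simp_all add: R_def P_def del: triangular.simps)
    moreover have "a m s = (-1) ^ s * R * P"
      by (simp add: a_def R_def P_def)
    ultimately show ?thesis by (simp add: algebra_simps)
  qed
  \<comment> \<open>The product in \<open>g s\<close> starts at \<open>i = s\<close>, so
    \<open>g 0\<close> contains the factor \<open>1 - fps_X ^ 0 = 0\<close>.\<close>
  have "(\<Prod>i\<in>{0..m}. 1 - fps_X ^ i :: int fps) = 0"
    by (rule prod_zero) (auto intro!: bexI[of _ 0])
  then have "g 0 = 0" by (simp add: g_def)
  have "(\<Sum>s\<le>Suc m. a (Suc m) s) = (\<Sum>s<Suc m. a m s + (g (Suc s) - g s)) + a (Suc m) (Suc m)"
    using step by (simp flip: lessThan_Suc_atMost)
  also have "\<dots> = (\<Sum>s\<le>m. a m s) + (g (Suc m) - g 0) + a (Suc m) (Suc m)"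
    using sum_lessThan_telescope[of g "Suc m"] by (simp add: sum.distrib lessThan_Suc_atMost)
  also note \<open>g 0 = 0\<close>
  \<comment> \<open>What remains of the telescoping sum and the new summand \<open>s = m + 1\<close>
    are exactly the two pentagonal terms of index \<open>m + 1\<close> and
    \<open>-(m + 1)\<close>.\<close>
  also have "g (Suc m) = (-1) ^ Suc m * fps_X ^ pentagonal (int (Suc m))"
    unfolding g_def pentagonal_of_nat by simp
  also have "a (Suc m) (Suc m) = (-1) ^ Suc m * fps_X ^ pentagonal (- int (Suc m))"
    unfolding a_def pentagonal_uminus_of_nat by simp
  also have "(\<Sum>s\<le>m. a m s) = (\<Sum>s\<in>{-int m..int m}. (-1) ^ nat \<bar>s\<bar> * fps_X ^ pentagonal s)"
    using Suc.IH unfolding a_def .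
  finally have *: "(\<Sum>s\<le>Suc m. a (Suc m) s) =
    (\<Sum>s\<in>{-int m..int m}. (-1) ^ nat \<bar>s\<bar> * fps_X ^ pentagonal s) +
    (-1) ^ Suc m * fps_X ^ pentagonal (int (Suc m)) +
    (-1) ^ Suc m * fps_X ^ pentagonal (- int (Suc m))"
    by simp
  have "{-int (Suc m)..int (Suc m)} = insert (int (Suc m)) (insert (- int (Suc m)) {-int m..int m})"
    by auto
  then have "(\<Sum>s\<in>{-int (Suc m)..int (Suc m)}. (-1) ^ nat \<bar>s\<bar> * fps_X ^ pentagonal s :: int fps) =
    (-1) ^ Suc m * fps_X ^ pentagonal (int (Suc m)) +
    ((-1) ^ Suc m * fps_X ^ pentagonal (- int (Suc m)) +
    (\<Sum>s\<in>{-int m..int m}. (-1) ^ nat \<bar>s\<bar> * fps_X ^ pentagonal s))"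
    by (simp add: nat_add_distrib del: of_nat_Suc power_Suc)
  with * show ?case unfolding a_def by (simp only: ac_simps)
qed

text \<open>In Shanks' sum every summand with \<open>s > 0\<close> has order at least
  \<open>n\<close>, so modulo q^n only the full product at \<open>s = 0\<close> is left.\<close>

lemma euler_product_cong_pentagonal:
  "fps_cong n euler_product (\<Sum>s\<in>{-int n..int n}. (-1) ^ nat \<bar>s\<bar> * fps_X ^ pentagonal s)"
proof -
  have "fps_cong n (q_pochhammer n) (\<Sum>s\<le>n. if s = 0 then q_pochhammer n else 0 :: int fps)"
    by simp
  also have "fps_cong n \<dots>
    (\<Sum>s\<le>n. (-1) ^ s * (\<Prod>i\<in>{s<..n}. 1 - fps_X ^ i) * fps_X ^ (s * n + triangular s))"
  proof (rule fps_cong_sum)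
    fix s
    have "n \<le> s * n + triangular s" if "s \<noteq> 0"
      using that by (cases s) auto
    then show "fps_cong n (if s = 0 then q_pochhammer n else 0)
      ((-1) ^ s * (\<Prod>i\<in>{s<..n}. 1 - fps_X ^ i) * fps_X ^ (s * n + triangular s) :: int fps)"
      by (auto simp: fps_cong_def fps_X_power_mult_right_nth q_pochhammer_def)
  qed
  also note shanks
  finally show ?thesis
    using euler_product_cong'[of n n] fps_cong_trans by fastforce
qed

lemma euler_product_nth_eq_sum:
  assumes "k < n"
  shows "euler_product $ k =
    (\<Sum>s\<in>{-int n..int n}. if pentagonal s = k then (-1) ^ nat \<bar>s\<bar> else 0)"
proof -
  have eq: "((-1) ^ m * f :: int fps) $ k = (-1) ^ m * f $ k" for m f
    by (cases "even m") auto
  show ?thesis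
    using euler_product_cong_pentagonal[of n] assms
    by (auto simp: fps_cong_def fps_sum_nth eq intro!: sum.cong)
qed

lemma pentagonal_ge: "\<bar>s\<bar> \<le> int (pentagonal s)"
proof -
  have "2 * \<bar>s\<bar> \<le> s * (3 * s - 1)"
  proof (cases "s \<ge> 1")
    case True
    then have "s * 2 \<le> s * (3 * s - 1)" by (intro mult_left_mono) auto
    with True show ?thesis by simp
  next
    case False
    then have "0 \<le> s * (3 * s + 1)"
      by (cases "s = 0") (auto intro!: mult_nonpos_nonpos)
    then show ?thesis using False by (simp add: algebra_simps)
  qed
  then show ?thesis using double_pentagonal[of s] by linarith
qed

lemma euler_product_nth_pentagonal: "euler_product $ pentagonal s = (-1) ^ nat \<bar>s\<bar>"
proof -
  have "euler_product $ pentagonal s =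
    (\<Sum>t\<in>{-int (Suc (pentagonal s))..int (Suc (pentagonal s))}. if t = s then (-1) ^ nat \<bar>s\<bar> else 0)"
    unfolding euler_product_nth_eq_sum[OF lessI]
    by (intro sum.cong) (auto dest: pentagonal_inj)
  also have "\<dots> = (-1) ^ nat \<bar>s\<bar>"
    using pentagonal_ge[of s] by (subst sum.delta) auto
  finally show ?thesis .
qed

lemma euler_product_nth_eq_0: "k \<notin> range pentagonal \<Longrightarrow> euler_product $ k = 0"
  unfolding euler_product_nth_eq_sum[OF lessI] by (intro sum.neutral) auto

subsection \<open>Jacobi's identity for the cube\<close>

fun q_binomial :: "nat \<Rightarrow> nat \<Rightarrow> 'a::comm_ring_1 fps" where
  "q_binomial n 0 = 1"
| "q_binomial 0 (Suc k) = 0"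
| "q_binomial (Suc n) (Suc k) = q_binomial n (Suc k) + fps_X ^ (n - k) * q_binomial n k"

lemma q_binomial_eq_0: "n < k \<Longrightarrow> q_binomial n k = 0"
  by (induction n k rule: q_binomial.induct) auto

lemma q_binomial_q_pochhammer:
  "k \<le> n \<Longrightarrow> q_pochhammer k * q_pochhammer (n - k) * q_binomial n k = (q_pochhammer n :: 'a::comm_ring_1 fps)"
proof (induction n k rule: q_binomial.induct)
  case (3 n k)
  show ?case
  proof (cases "k = n")
    case True
    then have "q_pochhammer n * q_binomial n n = (q_pochhammer n :: 'a fps)"
      using 3 by simp
    then have "q_pochhammer n * q_binomial n n * (1 - fps_X ^ Suc n) = q_pochhammer n * (1 - fps_X ^ Suc n :: 'a fps)"
      by (rule arg_cong)
    with True show ?thesis by (simp add: q_binomial_eq_0 q_pochhammer_Suc mult_ac)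
  next
    case False
    with 3 have IH: "q_pochhammer (Suc k) * q_pochhammer (n - Suc k) * q_binomial n (Suc k) = (q_pochhammer n :: 'a fps)"
      "q_pochhammer k * q_pochhammer (n - k) * q_binomial n k = (q_pochhammer n :: 'a fps)" and "k < n"
      by auto
    then have q: "q_pochhammer (n - k) = (q_pochhammer (n - Suc k) * (1 - fps_X ^ (n - k)) :: 'a fps)"
      by (metis Suc_diff_Suc q_pochhammer_Suc)
    have x: "fps_X ^ Suc n = (fps_X ^ (n - k) * fps_X ^ Suc k :: 'a fps)"
      using \<open>k < n\<close> by (simp flip: power_add power_Suc)
    have "q_pochhammer (Suc k) * q_pochhammer (Suc n - Suc k) * (q_binomial (Suc n) (Suc k) :: 'a fps) =
      (q_pochhammer (Suc k) * q_pochhammer (n - Suc k) * q_binomial n (Suc k)) * (1 - fps_X ^ (n - k)) +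
      (q_pochhammer k * q_pochhammer (n - k) * q_binomial n k) * (1 - fps_X ^ Suc k) * fps_X ^ (n - k)"
      by (simp add: q q_pochhammer_Suc[of k] algebra_simps del: power_Suc)
    also have "\<dots> = q_pochhammer (Suc n)"
      unfolding IH unfolding q_pochhammer_Suc x by (simp add: algebra_simps del: power_Suc)
    finally show ?thesis .
  qed
qed auto

lemma q_binomial_symmetric:
  assumes "k \<le> n"
  shows "q_binomial n (n - k) = (q_binomial n k :: 'a::idom fps)"
proof -
  have "q_pochhammer k * q_pochhammer (n - k) * q_binomial n (n - k) =
    q_pochhammer k * q_pochhammer (n - k) * (q_binomial n k :: 'a fps)"
    using q_binomial_q_pochhammer[OF assms, where 'a = 'a]
      q_binomial_q_pochhammer[of "n - k" n, where 'a = 'a] assms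
    by (simp add: mult_ac)
  then show ?thesis by simp
qed

text \<open>The q-binomial theorem, made homogeneous by \<open>y\<close>: putting
  \<open>y = q^N\<close> then avoids the negative powers of q in the classical argument.
  \<open>triangular (k - 1)\<close> is \<open>k (k - 1) / 2\<close>, also for
  \<open>k = 0\<close>.\<close>

lemma coeff_prod_q_binomial:
  fixes y :: "'a::idom fps"
  shows "poly.coeff (\<Prod>i<n. [:y, - (fps_X ^ i):]) k =
    (if k \<le> n then (-1) ^ k * fps_X ^ triangular (k - 1) * q_binomial n k * y ^ (n - k) else 0)"
proof (induction n arbitrary: k)
  case 0
  then show ?case by (cases k) auto
next
  case (Suc n)
  show ?case
  proof (cases k)
    case 0
    then show ?thesis using Suc by simp
  next
    case (Suc l)
    have x: "fps_X ^ n * fps_X ^ triangular (l - 1) = fps_X ^ triangular l * fps_X ^ (n - l)" if "l \<le> n"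
    proof -
      have "n + triangular (l - 1) = triangular l + (n - l)" using that by (cases l) auto
      then show ?thesis by (metis power_add)
    qed
    show ?thesis
    proof (cases "l < n")
      case True
      then have "y ^ (n - l) = y * y ^ (n - Suc l)" by (metis Suc_diff_Suc power_Suc)
      have id: "- (y * (e * T * B1 * Y)) - p * (e * T' * B0 * (y * Y)) = - (e * T * (B1 + r * B0) * (y * Y))"
        if "p * T' = T * r" for e T T' r p B0 B1 Y :: "'a fps"
      proof -
        have "- (y * (e * T * B1 * Y)) - p * (e * T' * B0 * (y * Y)) =
          - (y * (e * T * B1 * Y)) - (p * T') * (e * B0 * (y * Y))"
          by (simp add: algebra_simps)
        then show ?thesis unfolding that by (simp add: algebra_simps)
      qed
      show ?thesis
        using Suc True x \<open>y ^ (n - l) = _\<close> by (simp add: Suc.IH) (rule id, assumption)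
    next
      case False
      show ?thesis
      proof (cases "l = n")
        case True
        have "fps_X ^ n * fps_X ^ triangular (n - 1) = (fps_X ^ triangular n :: 'a fps)"
          using x[OF eq_imp_le[OF True]] unfolding True by (simp only: diff_self_eq_0 power_0 mult_1_right)
        note this[symmetric]
        with True show ?thesis using Suc by (simp add: Suc.IH q_binomial_eq_0 mult_ac)
      next
        case False
        then show ?thesis using Suc \<open>\<not> l < n\<close> by (simp add: Suc.IH)
      qed
    qed
  qed
qed

declare q_binomial.simps(3) [simp del]

text \<open>
  The finite form of Jacobi's identity: differentiate the \<open>q\<close>-binomial theorem for
  \<open>\<Prod>i\<le>2N. (q^N - u * q^i)\<close> at the zero \<open>u = 1\<close>.
\<close>

lemma finite_jacobi:
  "(\<Sum>j\<le>N. (-1) ^ j * of_nat (2 * j + 1) * fps_X ^ triangular j * q_binomial (2 * N + 1) (N - j)) =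
   (q_pochhammer N ^ 2 :: int fps)"
proof -
  define n where "n = 2 * N + 1"
  define F :: "int fps poly" where "F = (\<Prod>i<n. [:fps_X ^ N, - (fps_X ^ i):])"
  define G :: "int fps poly" where "G = (\<Prod>i\<in>{..<n} - {N}. [:fps_X ^ N, - (fps_X ^ i):])"
  \<comment> \<open>The power of q in \<open>fps_X ^ N * poly G 1\<close>:
    \<open>triangular (N - 1)\<close> from the factors \<open>i < N\<close>, \<open>N * N\<close>
    from those with \<open>i > N\<close>, and \<open>N\<close> from the factor in front.\<close>
  define M where "M = triangular (N - 1) + N * N + N"
  have F: "F = [:fps_X ^ N, - (fps_X ^ N):] * G"
    unfolding F_def G_def by (rule prod.remove) (auto simp: n_def)
  have S: "{..<n} - {N} = {..<N} \<union> (\<lambda>i. N + i) ` {0<..N}"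
  proof (intro equalityI subsetI)
    fix i assume "i \<in> {..<n} - {N}"
    then show "i \<in> {..<N} \<union> (\<lambda>i. N + i) ` {0<..N}"
      by (cases "i < N") (auto simp: n_def intro!: image_eqI[of _ _ "i - N"])
  qed (auto simp: n_def)
  have "poly G 1 = (\<Prod>i\<in>{..<n} - {N}. fps_X ^ N - fps_X ^ i)"
    unfolding G_def poly_prod by (intro prod.cong) simp_all
  also have "\<dots> = (\<Prod>i<N. fps_X ^ N - fps_X ^ i) * (\<Prod>i\<in>(\<lambda>i. N + i) ` {0<..N}. fps_X ^ N - fps_X ^ i)"
    unfolding S by (rule prod.union_disjoint) auto
  also have "(\<Prod>i\<in>(\<lambda>i. N + i) ` {0<..N}. fps_X ^ N - fps_X ^ i :: int fps) =
      (\<Prod>i\<in>{0<..N}. fps_X ^ N * (1 - fps_X ^ i))"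
    by (subst prod.reindex) (auto simp: power_add right_diff_distrib)
  also have "\<dots> = fps_X ^ (N * N) * q_pochhammer N"
    by (simp add: prod.distrib q_pochhammer_def power_mult)
  also have "(\<Prod>i<N. fps_X ^ N - fps_X ^ i :: int fps) = (\<Prod>i<N. - (fps_X ^ i) * (1 - fps_X ^ (N - i)))"
  proof (intro prod.cong refl)
    fix i assume "i \<in> {..<N}"
    then have *: "fps_X ^ i * fps_X ^ (N - i) = (fps_X ^ N :: int fps)"
      by (simp flip: power_add)
    show "fps_X ^ N - fps_X ^ i = - (fps_X ^ i) * (1 - fps_X ^ (N - i) :: int fps)"
      by (simp add: right_diff_distrib *)
  qed
  also have "\<dots> = (\<Prod>i<N. - (fps_X ^ i)) * (\<Prod>i<N. 1 - fps_X ^ (N - i))"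
    by (rule prod.distrib)
  also have "(\<Prod>i<N. 1 - fps_X ^ (N - i) :: int fps) = q_pochhammer N"
    unfolding q_pochhammer_def
    by (rule prod.reindex_bij_witness[of _ "\<lambda>i. N - i" "\<lambda>i. N - i"]) auto
  also have "(\<Prod>i<N. - (fps_X ^ i) :: int fps) = (-1) ^ N * fps_X ^ triangular (N - 1)"
  proof (induction N)
    case (Suc m)
    then show ?case by (cases m) (simp_all add: power_add)
  qed simp
  finally have G1: "fps_X ^ N * poly G 1 = (-1) ^ N * fps_X ^ M * q_pochhammer N ^ 2"
    by (simp add: M_def power_add power2_eq_square mult_ac)
  \<comment> \<open>Only the factor \<open>i = N\<close> vanishes at 1, so the product rule leaves
    its slope times the cofactor \<open>G\<close>.\<close>
  have "poly (pderiv F) 1 = - (fps_X ^ N * poly G 1)"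
    unfolding F pderiv_mult by (simp add: pderiv_pCons)
  also have "\<dots> = - ((-1) ^ N * fps_X ^ M * q_pochhammer N ^ 2)"
    by (simp add: G1)
  finally have "poly (pderiv F) 1 = \<dots>" .
  moreover have "poly (pderiv F) 1 =
    (\<Sum>j\<le>N. - ((-1) ^ N * fps_X ^ M * ((-1) ^ j * of_nat (2 * j + 1) * fps_X ^ triangular j * q_binomial n (N - j))))"
  proof -
    have cF: "poly.coeff F k = (if k \<le> n then (-1) ^ k * fps_X ^ triangular (k - 1) * q_binomial n k *
        (fps_X ^ N) ^ (n - k) else 0)" for k
      unfolding F_def by (rule coeff_prod_q_binomial)
    then have "degree F \<le> n"
      by (intro degree_le) auto
    then have "degree (pderiv F) \<le> 2 * N"
      by (simp add: degree_pderiv n_def)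
    then have "pderiv F = (\<Sum>k\<le>2*N. monom (poly.coeff (pderiv F) k) k)"
      by (rule poly_as_sum_of_monoms'[symmetric])
    then have "poly (pderiv F) 1 = poly (\<Sum>k\<le>2*N. monom (poly.coeff (pderiv F) k) k) 1"
      by (rule arg_cong)
    also have "\<dots> = (\<Sum>k\<le>2*N. poly.coeff (pderiv F) k)"
      by (simp add: poly_sum poly_monom)
    also have "\<dots> = (\<Sum>k\<le>2*N. of_nat (Suc k) * poly.coeff F (Suc k))"
      by (simp add: coeff_pderiv)
    also have "\<dots> = (\<Sum>k\<le>n. of_nat k * poly.coeff F k)"
      unfolding n_def Suc_eq_plus1[symmetric] sum.atMost_Suc_shift by simp
    \<comment> \<open>The indices \<open>N - j\<close> and \<open>N + 1 + j\<close> are paired. By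
      the symmetry of the q-binomials their coefficients are opposite, so the weights from the
      derivative subtract to \<open>2 * j + 1\<close>.\<close>
    also have "{..n} = {..N} \<union> {Suc N..n}"
      by (auto simp: n_def)
    also have "(\<Sum>k\<in>{..N} \<union> {Suc N..n}. of_nat k * poly.coeff F k) =
      (\<Sum>k\<le>N. of_nat k * poly.coeff F k) + (\<Sum>k\<in>{Suc N..n}. of_nat k * poly.coeff F k)"
      by (rule sum.union_disjoint) auto
    also have "(\<Sum>k\<le>N. of_nat k * poly.coeff F k) =
      (\<Sum>j\<le>N. of_nat (N - j) * poly.coeff F (N - j))"
      by (rule sum.reindex_bij_witness[of _ "\<lambda>i. N - i" "\<lambda>i. N - i"]) auto
    also have "(\<Sum>k\<in>{Suc N..n}. of_nat k * poly.coeff F k) =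
      (\<Sum>j\<le>N. of_nat (Suc N + j) * poly.coeff F (Suc N + j))"
      by (rule sum.reindex_bij_witness[of _ "\<lambda>j. Suc N + j" "\<lambda>k. k - Suc N"]) (auto simp: n_def)
    also have "(\<Sum>j\<le>N. of_nat (N - j) * poly.coeff F (N - j)) + \<dots> =
      (\<Sum>j\<le>N. of_nat (N - j) * poly.coeff F (N - j) + of_nat (Suc N + j) * poly.coeff F (Suc N + j))"
      by (rule sum.distrib[symmetric])
    also have "\<dots> = (\<Sum>j\<le>N. - ((-1) ^ N * fps_X ^ M *
      ((-1) ^ j * of_nat (2 * j + 1) * fps_X ^ triangular j * q_binomial n (N - j))))"
    proof (intro sum.cong refl)
      fix j assume "j \<in> {..N}"
      then obtain i where N: "N = j + i" by (auto simp: le_iff_add)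
      have e1: "triangular (N - j - 1) + N * (n - (N - j)) = M + triangular j"
      proof -
        have "2 * (triangular (N - j - 1) + N * (n - (N - j))) = 2 * (M + triangular j)"
          unfolding distrib_left double_triangular M_def N n_def
          by (cases i; cases j) (auto simp: algebra_simps)
        then show ?thesis by simp
      qed
      have e2: "triangular (Suc N + j - 1) + N * (n - (Suc N + j)) = M + triangular j"
      proof -
        have "2 * (triangular (Suc N + j - 1) + N * (n - (Suc N + j))) = 2 * (M + triangular j)"
          unfolding distrib_left double_triangular M_def N n_def
          by (cases i; cases j) (auto simp: algebra_simps)
        then show ?thesis by simp
      qed
      have s: "q_binomial n (Suc N + j) = (q_binomial n (N - j) :: int fps)"
      proof -
        have "n - (N - j) = Suc N + j" by (simp add: n_def N)
        moreover have "N - j \<le> n" by (simp add: n_def N)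
        ultimately show ?thesis using q_binomial_symmetric[of "N - j" n, where 'a = int] by simp
      qed
      have "(-1) ^ (N - j) = ((-1) ^ N * (-1) ^ j :: int fps)"
        unfolding N by (simp add: power_add mult_ac flip: power_mult_distrib)
      then have c1: "poly.coeff F (N - j) = (-1) ^ N * (-1) ^ j * fps_X ^ (M + triangular j) * q_binomial n (N - j)"
        unfolding cF e1[symmetric] power_add power_mult by (simp add: n_def mult_ac)
      have "Suc N + j \<le> n" by (simp add: n_def N)
      then have c2: "poly.coeff F (Suc N + j) = - ((-1) ^ N * (-1) ^ j * fps_X ^ (M + triangular j) * q_binomial n (N - j))"
        unfolding cF e2[symmetric] s[symmetric] power_add power_mult by (simp add: mult_ac)
      have "of_nat (Suc N + j) = of_nat (N - j) + (of_nat (2 * j + 1) :: int fps)"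
        unfolding of_nat_add[symmetric] by (rule arg_cong[of _ _ of_nat]) (simp add: N)
      then show "of_nat (N - j) * poly.coeff F (N - j) + of_nat (Suc N + j) * poly.coeff F (Suc N + j) =
        - ((-1) ^ N * fps_X ^ M * ((-1) ^ j * of_nat (2 * j + 1) * fps_X ^ triangular j * q_binomial n (N - j)))"
        unfolding c1 c2 power_add by (simp only:) (simp add: algebra_simps)
    qed
    finally show ?thesis .
  qed
  ultimately have "(-1) ^ N * fps_X ^ M * q_pochhammer N ^ 2 = (-1) ^ N * fps_X ^ M *
    (\<Sum>j\<le>N. (-1) ^ j * of_nat (2 * j + 1) * fps_X ^ triangular j * (q_binomial n (N - j) :: int fps))"
    unfolding sum_distrib_left sum_negf by simp
  then show ?thesis by (simp add: n_def)
qed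


text \<open>Multiply \<open>finite_jacobi\<close> by Euler's product. Then
  \<open>euler_product * q_binomial (2 * N + 1) (N - j)\<close> is 1 modulo q^(N - j + 1), and the
  missing \<open>j\<close> orders are supplied by \<open>fps_X ^ triangular j\<close>.\<close>

lemma euler_product_cube_cong:
  "fps_cong (Suc N) (euler_product ^ 3) (\<Sum>j\<le>N. (-1) ^ j * of_nat (2 * j + 1) * fps_X ^ triangular j)"
proof -
  have "fps_cong (Suc N) (euler_product * q_pochhammer N ^ 2) (euler_product * euler_product ^ 2)"
    by (intro fps_cong_mult fps_cong_power fps_cong_refl fps_cong_sym[OF euler_product_cong']) simp
  then have "fps_cong (Suc N) (euler_product ^ 3) (euler_product * q_pochhammer N ^ 2)"
    by (simp add: power3_eq_cube power2_eq_square mult.assoc fps_cong_sym)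
  also have "euler_product * q_pochhammer N ^ 2 = (\<Sum>j\<le>N. (-1) ^ j * of_nat (2 * j + 1) *
      (fps_X ^ triangular j * (euler_product * q_binomial (2 * N + 1) (N - j))))"
    unfolding finite_jacobi[symmetric] sum_distrib_left by (simp add: mult_ac)
  also have "fps_cong (Suc N) \<dots> (\<Sum>j\<le>N. (-1) ^ j * of_nat (2 * j + 1) * (fps_X ^ triangular j * 1))"
  proof (intro fps_cong_sum, rule fps_cong_mult[OF fps_cong_refl])
    fix j assume j: "j \<in> {..N}"
    let ?B = "q_binomial (2 * N + 1) (N - j) :: int fps" and ?M = "Suc (N - j)"
    have [simp]: "2 * N + 1 - (N - j) = Suc N + j" using j by auto
    have "fps_cong ?M (euler_product * euler_product * ?B)
      (q_pochhammer (N - j) * q_pochhammer (Suc N + j) * ?B)"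
      by (intro fps_cong_mult euler_product_cong' fps_cong_refl) auto
    also have "\<dots> = q_pochhammer (2 * N + 1)"
      using q_binomial_q_pochhammer[of "N - j" "2 * N + 1", where 'a = int] j by simp
    also have "fps_cong ?M \<dots> euler_product"
      by (intro fps_cong_sym[OF euler_product_cong']) auto
    finally have "fps_cong ?M (fps_right_inverse euler_product 1 * (euler_product * euler_product * ?B))
      (fps_right_inverse euler_product 1 * euler_product)"
      by (intro fps_cong_mult fps_cong_refl)
    moreover have inv: "fps_right_inverse euler_product 1 * euler_product = 1"
      using fps_right_inverse[of euler_product 1] by (simp add: mult.commute)
    ultimately have "fps_cong ?M (euler_product * ?B) 1"
      by (simp add: mult.assoc[symmetric])
    then have "fps_cong (?M + triangular j) (fps_X ^ triangular j * (euler_product * ?B)) (fps_X ^ triangular j * 1)"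
      by (rule fps_cong_fps_X_power_mult)
    then show "fps_cong (Suc N) (fps_X ^ triangular j * (euler_product * ?B)) (fps_X ^ triangular j * 1)"
      by (rule fps_cong_mono) (use triangular_ge[of j] j in auto)
  qed
  finally show ?thesis by simp
qed

text \<open>If \<open>n\<close> is triangular then \<open>8 * n + 1\<close> is a square, but it is 2
  modulo 5, a non-residue.\<close>

lemma euler_product_cube_nth_eq_0:
  assumes "[n = 2] (mod 5)"
  shows "(euler_product ^ 3) $ n = 0"
proof -
  have eq: "((-1) ^ m * of_nat l * f :: int fps) $ k = (-1) ^ m * of_nat l * f $ k" for m l f k
    by (cases "even m") (auto simp flip: fps_of_nat)
  have "triangular j \<noteq> n" for j
  proof
    assume "triangular j = n"
    then have "2 * n = j * (j + 1)" using double_triangular[of j] by simp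
    then have "8 * n + 1 = (2 * j + 1) * (2 * j + 1)" by (simp add: algebra_simps)
    moreover have "(8 * n + 1) mod 5 = 2"
      using assms by (simp add: cong_def) presburger
    moreover have "((2 * j + 1) * (2 * j + 1)) mod 5 = (((2 * j + 1) mod 5) * ((2 * j + 1) mod 5)) mod 5"
      by (simp add: mod_mult_eq)
    moreover have "(2 * j + 1) mod 5 \<in> {0, 1, 2, 3, 4}" by auto
    ultimately show False by auto
  qed
  then have "(\<Sum>j\<le>n. (-1) ^ j * of_nat (2 * j + 1) * fps_X ^ triangular j :: int fps) $ n = 0"
    unfolding fps_sum_nth eq by (intro sum.neutral) auto
  then show ?thesis
    using euler_product_cube_cong[of n] by (simp add: fps_cong_def)
qed

subsection \<open>The 5-dissection of Euler's product\<close>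

definition part5 :: "nat \<Rightarrow> int fps" where
  "part5 r = Abs_fps (\<lambda>n. if n mod 5 = r then euler_product $ n else 0)"

abbreviation "euler0 \<equiv> part5 0"
abbreviation "euler2 \<equiv> part5 2"

definition e25 :: "int fps" where
  "e25 = fps_X * dil (dil euler_product)"

lemma mult_mod_5: "(s * (3 * s - 1)) mod 5 = ((s mod 5) * (3 * (s mod 5) - 1)) mod (5 :: int)"
proof -
  have "[s * (3 * s - 1) = (s mod 5) * (3 * (s mod 5) - 1)] (mod 5)"
    by (intro cong_mult cong_diff cong_refl) (simp_all add: cong_def)
  then show ?thesis by (simp add: cong_def)
qed

text \<open>Modulo 5, \<open>s (3s - 1) = 2\<close> forces \<open>s = 1\<close>; and
  \<open>(5u + 1)(15u + 2) = 25 u (3u + 1) + 2\<close>.\<close>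

lemma pentagonal_eq_1_mod_5:
  assumes "pentagonal s mod 5 = 1"
  obtains u where "s = 5 * u + 1" "pentagonal s = 25 * pentagonal (- u) + 1"
proof -
  have p: "2 * int (pentagonal s) = s * (3 * s - 1)" by (rule double_pentagonal)
  have "int (pentagonal s) mod 5 = 1"
    using assms by presburger
  then have "(2 * int (pentagonal s)) mod 5 = 2" by presburger
  then have "(s * (3 * s - 1)) mod 5 = 2" using p by simp
  moreover have "(s * (3 * s - 1)) mod 5 = ((s mod 5) * (3 * (s mod 5) - 1)) mod 5"
    by (rule mult_mod_5)
  moreover have "s mod 5 \<in> {0, 1, 2, 3, 4}" by auto
  ultimately have "s mod 5 = 1" by auto
  then have s: "s = 5 * (s div 5) + 1" by presburger
  define u where "u = s div 5"
  have "2 * int (pentagonal s) = 25 * (2 * int (pentagonal (- u))) + 2"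
    unfolding double_pentagonal using s by (simp add: u_def[symmetric] algebra_simps)
  with s show ?thesis
    using that[of u] by (simp add: u_def[symmetric])
qed

lemma pentagonal_mod_5: "pentagonal s mod 5 \<in> {0, 1, 2}"
proof -
  have p: "2 * int (pentagonal s) = s * (3 * s - 1)" by (rule double_pentagonal)
  have "(s * (3 * s - 1)) mod 5 = ((s mod 5) * (3 * (s mod 5) - 1)) mod 5"
    by (rule mult_mod_5)
  moreover have "s mod 5 \<in> {0, 1, 2, 3, 4}" by auto
  ultimately have "(2 * int (pentagonal s)) mod 5 \<in> {0, 2, 4}" using p by auto
  then show ?thesis by auto presburger+
qed

lemma mod_5_eq_1:
  fixes n :: nat
  assumes "n mod 25 = 1"
  shows "n mod 5 = 1"
proof -
  have "n mod 5 = n mod 25 mod 5" by (simp add: mod_mod_cancel)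
  with assms show ?thesis by simp
qed

lemma e25_nth:
  "e25 $ n = (if n mod 25 = 1 then euler_product $ (n div 25) else 0)"
proof (cases n)
  case (Suc m)
  have "dil (dil f) $ m = (if 25 dvd m then f $ (m div 25) else 0)" for f :: "int fps"
  proof (cases "5 dvd m")
    case True
    then obtain k where "m = 5 * k" by (elim dvdE)
    then show ?thesis by (auto simp: dil_nth elim!: dvdE)
  next
    case False
    then have "\<not> 25 dvd m" using dvd_trans[of 5 25 m] by auto
    with False show ?thesis by (simp add: dil_nth)
  qed
  moreover have "25 dvd m \<longleftrightarrow> n mod 25 = 1" "25 dvd m \<Longrightarrow> m div 25 = n div 25"
    using Suc by (auto simp: mod_Suc div_Suc dvd_eq_mod_eq_0)
  ultimately show ?thesis using Suc by (simp add: e25_def)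
qed (simp add: e25_def)

lemma euler_product_nth_1_mod_5:
  assumes "n mod 5 = 1"
  shows "euler_product $ n = - (e25 $ n)"
proof (cases "n \<in> range pentagonal")
  case True
  then obtain s where n: "n = pentagonal s" by auto
  with assms obtain u where u: "s = 5 * u + 1" "n = 25 * pentagonal (- u) + 1"
    using pentagonal_eq_1_mod_5 by metis
  then have "n mod 25 = 1" "n div 25 = pentagonal (- u)" by auto
  \<comment> \<open>\<open>5 * u + 1\<close> and \<open>u\<close> have opposite parity, whence the
    minus sign in front of \<open>e25\<close>.\<close>
  moreover have "(-1) ^ nat \<bar>s\<bar> = (- ((-1) ^ nat \<bar>- u\<bar>) :: int)"
  proof -
    have "even (nat \<bar>s\<bar>) \<longleftrightarrow> odd (nat \<bar>- u\<bar>)" using u by (simp add: even_nat_iff)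
    then show ?thesis by (auto simp: minus_one_power_iff)
  qed
  ultimately show ?thesis
    by (simp add: e25_nth euler_product_nth_pentagonal n)
next
  case False
  have "euler_product $ (n div 25) = 0" if "n mod 25 = 1"
  proof (rule euler_product_nth_eq_0, rule notI)
    assume "n div 25 \<in> range pentagonal"
    then obtain v where v: "n div 25 = pentagonal v" by auto
    have "2 * int (pentagonal (1 - 5 * v)) = 25 * (2 * int (pentagonal v)) + 2"
      unfolding double_pentagonal by (simp add: algebra_simps)
    then have "n = pentagonal (1 - 5 * v)" using v that div_mult_mod_eq[of n 25] by linarith
    with False show False by auto
  qed
  with False show ?thesis by (simp add: e25_nth euler_product_nth_eq_0)
qed

lemma euler_product_dissection: "euler_product = euler0 - e25 + euler2"
proof (rule fps_ext)
  fix n :: nat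
  have "n mod 5 = 0 \<or> n mod 5 = 1 \<or> n mod 5 = 2 \<or> n mod 5 \<notin> {0, 1, 2}" by auto
  moreover have "euler_product $ n = 0" if "n mod 5 \<notin> {0, 1, 2}"
    using that pentagonal_mod_5 by (intro euler_product_nth_eq_0) (metis imageE)
  moreover have "n mod 25 \<noteq> 1" if "n mod 5 \<noteq> 1"
    using that mod_5_eq_1 by blast
  ultimately show "euler_product $ n = (euler0 - e25 + euler2) $ n"
    by (auto simp: part5_def e25_nth euler_product_nth_1_mod_5)
qed

lemma in_class_part5: "in_class r (part5 r)"
  by (auto simp: in_class_def part5_def cong_def split: if_splits)

lemma in_class_e25: "in_class 1 e25"
  by (auto simp: in_class_def e25_nth cong_def dest: mod_5_eq_1[unfolded One_nat_def] split: if_splits)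

lemma in_class_nth_eq_0: "in_class r f \<Longrightarrow> n mod 5 \<noteq> r mod 5 \<Longrightarrow> f $ n = 0"
  by (auto simp: in_class_def cong_def)

lemma euler0_nth_0 [simp]: "euler0 $ 0 = 1"
  by (simp add: part5_def)

lemma euler0_nonzero [simp]: "euler0 \<noteq> 0"
  by (metis euler0_nth_0 fps_zero_nth zero_neq_one)

text \<open>Compare the coefficients of \<open>q^(5n+2)\<close> in the cube of Euler's product, which all vanish.\<close>

lemma euler0_euler2: "euler0 * euler2 = - e25\<^sup>2"
proof -
  \<comment> \<open>Of the monomials in the cube of \<open>euler0 - e25 + euler2\<close> only these
    two have exponents congruent to 2 modulo 5. Cancelling \<open>euler0\<close> leaves the
    claim.\<close>
  let ?M = "euler0 ^ 2 * euler2 + euler0 * e25 ^ 2"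
  have "?M $ n = 0" for n
  proof (cases "n mod 5 = 2")
    case True
    have m: "(euler0 ^ i * (e25 ^ j * euler2 ^ k)) $ n = 0" if "(j + k * 2) mod 5 \<noteq> 2" for i j k
    proof -
      have "in_class (i * 0 + (j * 1 + k * 2)) (euler0 ^ i * (e25 ^ j * euler2 ^ k))"
        by (intro in_class_mult in_class_power in_class_part5 in_class_e25)
      then show ?thesis by (rule in_class_nth_eq_0) (use that True in simp)
    qed
    have m012: "(e25 * euler2 ^ 2) $ n = 0"
      using m[where i = 0 and j = 1 and k = 2] by (simp add: mod_Suc)
    have "euler_product ^ 3 = 3 * ?M + (euler0 ^ 3 - e25 ^ 3 + euler2 ^ 3 - 3 * (euler0 ^ 2 * e25) + 3 * (euler0 * euler2 ^ 2)
      - 6 * (euler0 * (e25 * euler2)) + 3 * (e25 ^ 2 * euler2) - 3 * (e25 * euler2 ^ 2))"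
      unfolding euler_product_dissection by (simp add: power2_eq_square power3_eq_cube algebra_simps)
    then have "(euler_product ^ 3) $ n = 3 * ?M $ n"
      using m012 m[of 0 0 3] m[of 3 0 0] m[of 0 3 0] m[of 2 1 0] m[of 1 0 2] m[of 1 1 1] m[of 0 2 1]
      by (simp add: numeral_fps_const)
    moreover have "(euler_product ^ 3) $ n = 0"
      by (rule euler_product_cube_nth_eq_0) (use True in \<open>simp add: cong_def\<close>)
    ultimately show ?thesis by simp
  next
    case False
    have "in_class (2 * 0 + 2) (euler0 ^ 2 * euler2)" "in_class (0 + 2 * 1) (euler0 * e25 ^ 2)"
      by (intro in_class_mult in_class_power in_class_part5 in_class_e25)+
    then have "in_class 2 ?M" by (simp add: in_class_add numeral_2_eq_2)
    with False show ?thesis using in_class_nth_eq_0[of 2 ?M n] by simp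
  qed
  then have "euler0 * (euler0 * euler2 + e25 ^ 2) = 0"
    by (simp add: fps_eq_iff power2_eq_square algebra_simps)
  then show ?thesis by (simp add: eq_neg_iff_add_eq_0)
qed

section \<open>The norm over the fifth roots of unity\<close>

definition fps_twist :: "'a \<Rightarrow> 'a::comm_ring_1 fps \<Rightarrow> 'a fps" where
  "fps_twist w f = Abs_fps (\<lambda>n. w ^ n * f $ n)"

lemma fps_twist_nth: "fps_twist w f $ n = w ^ n * f $ n"
  by (simp add: fps_twist_def)

lemma fps_twist_1 [simp]: "fps_twist w 1 = 1"
  and fps_twist_add: "fps_twist w (f + g) = fps_twist w f + fps_twist w g"
  and fps_twist_diff: "fps_twist w (f - g) = fps_twist w f - fps_twist w g"
  by (simp_all add: fps_eq_iff fps_twist_nth algebra_simps)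

lemma fps_twist_mult: "fps_twist w (f * g) = fps_twist w f * fps_twist w g"
proof (rule fps_ext)
  fix n
  have "fps_twist w (f * g) $ n = (\<Sum>i=0..n. w ^ (i + (n - i)) * (f $ i * g $ (n - i)))"
    by (simp add: fps_twist_nth fps_mult_nth sum_distrib_left)
  also have "\<dots> = (fps_twist w f * fps_twist w g) $ n"
    unfolding fps_mult_nth power_add by (simp add: fps_twist_nth mult_ac)
  finally show "fps_twist w (f * g) $ n = (fps_twist w f * fps_twist w g) $ n" .
qed

lemma fps_twist_fps_X_power: "fps_twist w (fps_X ^ k) = fps_const (w ^ k) * fps_X ^ k"
  by (simp add: fps_eq_iff fps_twist_nth)

lemma fps_twist_in_class:
  assumes "in_class r f" "w ^ 5 = 1"
  shows "fps_twist w f = fps_const (w ^ r) * f"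
proof (rule fps_ext)
  fix n
  have "w ^ n = w ^ r" if "[n = r] (mod 5)"
  proof -
    have "w ^ k = w ^ (k mod 5)" for k
    proof -
      have "w ^ k = w ^ (5 * (k div 5) + k mod 5)" by simp
      also have "\<dots> = w ^ (k mod 5)" unfolding power_add power_mult assms(2) by simp
      finally show ?thesis .
    qed
    with that show ?thesis by (metis cong_def)
  qed
  with assms(1) have "w ^ n = w ^ r" if "f $ n \<noteq> 0"
    using that by (simp add: in_class_def)
  then show "fps_twist w f $ n = (fps_const (w ^ r) * f) $ n"
    by (cases "f $ n = 0") (simp_all add: fps_twist_nth)
qed

lemma fps_cong_twist: "fps_cong N f g \<Longrightarrow> fps_cong N (fps_twist w f) (fps_twist w g)"
  by (auto simp: fps_cong_def fps_twist_nth)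

text \<open>
  With \<open>w\<close> a primitive fifth root of unity, the factors for \<open>w^4, w\<close> and for \<open>w^2, w^3\<close> are
  paired; the sums \<open>w + w^4\<close> and \<open>w^2 + w^3\<close> have sum and product \<open>-1\<close>.
\<close>

lemma norm_fifth_root:
  fixes w A B C :: "'a::comm_ring_1"
  assumes "1 + w + w ^ 2 + w ^ 3 + w ^ 4 = 0" "w ^ 5 = 1"
  defines "K \<equiv> A ^ 2 + B ^ 2 + C ^ 2" and "L \<equiv> B * (A + C)" and "M \<equiv> A * C"
  shows "(A - B + C) * (A - w * B + w ^ 2 * C) * (A - w ^ 2 * B + w ^ 4 * C) *
    (A - w ^ 3 * B + w * C) * (A - w ^ 4 * B + w ^ 3 * C) =
    (A - B + C) * (K ^ 2 + K * L - K * M - L ^ 2 - 3 * L * M - M ^ 2)"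
proof -
  define s t where "s = w + w ^ 4" and "t = w ^ 2 + w ^ 3"
  have w: "w * w ^ 4 = 1" "w ^ 2 * w ^ 3 = 1" "w ^ 2 * w ^ 4 = w" "w * w ^ 2 = w ^ 3"
    "w * w ^ 3 = w ^ 4" "w ^ 3 * w ^ 4 = w ^ 2"
  proof -
    have *: "w ^ 6 = w" "w ^ 7 = w ^ 2"
      using power_add[of w 5 1] power_add[of w 5 2] assms(2) by simp_all
    show "w * w ^ 4 = 1" using power_add[of w 1 4] assms(2) by simp
    show "w ^ 2 * w ^ 3 = 1" using power_add[of w 2 3] assms(2) by simp
    show "w ^ 2 * w ^ 4 = w" using power_add[of w 2 4] * by simp
    show "w * w ^ 2 = w ^ 3" by (simp add: power3_eq_cube power2_eq_square)
    show "w * w ^ 3 = w ^ 4" using power_add[of w 1 3] by simp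
    show "w ^ 3 * w ^ 4 = w ^ 2" using power_add[of w 3 4] * by simp
  qed
  have st: "t = - 1 - s" "s * t = - 1"
  proof -
    show "t = - 1 - s" using assms(1) by (simp add: s_def t_def algebra_simps eq_neg_iff_add_eq_0)
    have "s * t = w * w ^ 2 + w * w ^ 3 + w ^ 2 * w ^ 4 + w ^ 3 * w ^ 4"
      by (simp add: s_def t_def algebra_simps)
    also have "\<dots> = (1 + w + w ^ 2 + w ^ 3 + w ^ 4) - 1" unfolding w by (simp add: algebra_simps)
    finally show "s * t = - 1" using assms(1) by simp
  qed
  have 1: "(A - w * B + w ^ 2 * C) * (A - w ^ 4 * B + w ^ 3 * C) = K - s * L + t * M"
  proof -
    have "(A - w * B + w ^ 2 * C) * (A - w ^ 4 * B + w ^ 3 * C) =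
      A ^ 2 + (w * w ^ 4) * B ^ 2 + (w ^ 2 * w ^ 3) * C ^ 2 - (w + w ^ 4) * (A * B) -
      (w * w ^ 3 + w ^ 2 * w ^ 4) * (B * C) + (w ^ 2 + w ^ 3) * (A * C)"
      by (simp add: power2_eq_square algebra_simps)
    then show ?thesis
      unfolding w by (simp add: s_def t_def K_def L_def M_def algebra_simps)
  qed
  have 2: "(A - w ^ 2 * B + w ^ 4 * C) * (A - w ^ 3 * B + w * C) = K - t * L + s * M"
  proof -
    have "(A - w ^ 2 * B + w ^ 4 * C) * (A - w ^ 3 * B + w * C) =
      A ^ 2 + (w ^ 2 * w ^ 3) * B ^ 2 + (w * w ^ 4) * C ^ 2 - (w ^ 2 + w ^ 3) * (A * B) -
      (w * w ^ 2 + w ^ 3 * w ^ 4) * (B * C) + (w + w ^ 4) * (A * C)"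
      by (simp add: power2_eq_square algebra_simps)
    then show ?thesis
      unfolding w by (simp add: s_def t_def K_def L_def M_def algebra_simps)
  qed
  have "(K - s * L + t * M) * (K - t * L + s * M) = K ^ 2 - (s + t) * K * L + (s + t) * K * M
     + s * t * L ^ 2 - ((s + t) ^ 2 - 2 * (s * t)) * L * M + s * t * M ^ 2"
    by (simp add: power2_eq_square algebra_simps)
  also have "\<dots> = K ^ 2 + K * L - K * M - L ^ 2 - 3 * L * M - M ^ 2"
    unfolding st(2) by (simp add: st(1))
  finally have "(A - B + C) * (((A - w * B + w ^ 2 * C) * (A - w ^ 4 * B + w ^ 3 * C)) *
    ((A - w ^ 2 * B + w ^ 4 * C) * (A - w ^ 3 * B + w * C))) =
    (A - B + C) * (K ^ 2 + K * L - K * M - L ^ 2 - 3 * L * M - M ^ 2)"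
    unfolding 1 2 by simp
  then show ?thesis by (simp only: mult.assoc mult.commute mult.left_commute)
qed


lemma norm_fifth_root_linear:
  fixes w x :: "'a::comm_ring_1"
  assumes "1 + w + w ^ 2 + w ^ 3 + w ^ 4 = 0" "w ^ 5 = 1"
  shows "(1 - x) * (1 - w * x) * (1 - w ^ 2 * x) * (1 - w ^ 3 * x) * (1 - w ^ 4 * x) = 1 - x ^ 5"
  using norm_fifth_root[OF assms, of 1 x 0] by (simp add: algebra_simps eval_nat_numeral)

text \<open>With \<open>A = B / R\<close> the hypothesis reads \<open>C = - B R\<close>, and the
  right-hand side becomes \<open>B^5 (1/R^5 - 11 - R^5)\<close>, the expression in Ramanujan's
  identity for the Rogers-Ramanujan continued fraction.\<close>

lemma norm_fifth_root_quadratic: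
  fixes w A B C :: "'a::idom"
  assumes "1 + w + w ^ 2 + w ^ 3 + w ^ 4 = 0" "w ^ 5 = 1" and AC: "A * C = - (B ^ 2)"
  shows "(A - B + C) * (A - w * B + w ^ 2 * C) * (A - w ^ 2 * B + w ^ 4 * C) *
    (A - w ^ 3 * B + w * C) * (A - w ^ 4 * B + w ^ 3 * C) = A ^ 5 - 11 * B ^ 5 + C ^ 5"
proof -
  show ?thesis
    unfolding norm_fifth_root[OF assms(1,2)] using AC by algebra
qed

text \<open>Passage to complex coefficients, where a primitive fifth root of unity exists;
  \<open>cplx_inject\<close> brings the resulting identity back to the integers.\<close>

definition cplx :: "int fps \<Rightarrow> complex fps" where
  "cplx f = Abs_fps (\<lambda>n. of_int (f $ n))"

lemma cplx_nth [simp]: "cplx f $ n = of_int (f $ n)"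
  by (simp add: cplx_def)

lemma cplx_inject: "cplx f = cplx g \<longleftrightarrow> f = g"
  by (simp add: fps_eq_iff)

lemma cplx_1 [simp]: "cplx 1 = 1"
  and cplx_numeral [simp]: "cplx (numeral k) = numeral k"
  and cplx_fps_X_power [simp]: "cplx (fps_X ^ n) = fps_X ^ n"
  and cplx_add: "cplx (f + g) = cplx f + cplx g"
  and cplx_diff: "cplx (f - g) = cplx f - cplx g"
  and cplx_uminus: "cplx (- f) = - cplx f"
  by (simp_all add: fps_eq_iff numeral_fps_const)

lemma cplx_mult: "cplx (f * g) = cplx f * cplx g"
  by (simp add: fps_eq_iff fps_mult_nth)

lemma cplx_power: "cplx (f ^ k) = cplx f ^ k"
  by (induction k) (simp_all add: cplx_mult)

lemma cplx_dil: "cplx (dil f) = dil (cplx f)"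
  by (simp add: fps_eq_iff dil_nth)

lemma cplx_q_pochhammer: "cplx (q_pochhammer n) = q_pochhammer n"
  by (induction n) (simp_all add: q_pochhammer_Suc cplx_mult cplx_diff del: power_Suc)

lemma in_class_cplx: "in_class r f \<Longrightarrow> in_class r (cplx f)"
  by (simp add: in_class_def)

lemma fps_cong_cplx: "fps_cong N f g \<Longrightarrow> fps_cong N (cplx f) (cplx g)"
  by (simp add: fps_cong_def)

definition zeta :: complex where
  "zeta = cis (2 * pi / 5)"

lemma zeta_power_5: "zeta ^ 5 = 1"
  unfolding zeta_def Complex.DeMoivre by simp

lemma zeta_power_mod: "zeta ^ n = zeta ^ (n mod 5)"
proof -
  have "zeta ^ n = zeta ^ (5 * (n div 5) + n mod 5)" by simp
  also have "\<dots> = zeta ^ (n mod 5)" unfolding power_add power_mult zeta_power_5 by simp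
  finally show ?thesis .
qed

lemma zeta_neq_1: "zeta \<noteq> 1"
proof
  assume "zeta = 1"
  then have "cos (2 * pi / 5) = 1" by (simp add: zeta_def complex_eq_iff)
  moreover have "cos (2 * pi / 5) < cos 0" by (rule cos_monotone_0_pi) auto
  ultimately show False by simp
qed

lemma zeta_power_eq_1_iff: "zeta ^ n = 1 \<longleftrightarrow> 5 dvd n"
proof
  assume eq: "zeta ^ n = 1"
  show "5 dvd n"
  proof (rule ccontr)
    assume "\<not> 5 dvd n"
    then have "coprime n 5" using prime_imp_coprime[of 5 n] by (simp add: coprime_commute)
    then obtain k where "[n * k = 1] (mod 5)" using cong_solve_coprime_nat by auto
    then have "(n * k) mod 5 = 1" by (simp add: cong_def)
    then have "zeta = zeta ^ (n * k)" by (metis power_one_right zeta_power_mod)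
    also have "\<dots> = 1" unfolding power_mult eq by simp
    finally show False using zeta_neq_1 by simp
  qed
qed (auto simp: power_mult zeta_power_5 elim!: dvdE)

lemma zeta_power_primitive:
  assumes "\<not> 5 dvd n"
  defines "w \<equiv> fps_const (zeta ^ n) :: complex fps"
  shows "1 + w + w ^ 2 + w ^ 3 + w ^ 4 = 0" "w ^ 5 = 1"
proof -
  have w: "w ^ 5 = 1" 
    by (simp add: w_def zeta_power_5 flip: power_mult) (simp add: power_mult mult.commute[of n] zeta_power_5)
  then show "w ^ 5 = 1" .
  have "(w - 1) * (1 + w + w ^ 2 + w ^ 3 + w ^ 4) = w ^ 5 - 1"
    by (simp add: algebra_simps eval_nat_numeral)
  moreover have "w \<noteq> 1"
    using assms(1) zeta_power_eq_1_iff[of n] by (simp add: w_def flip: fps_const_1_eq_1)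
  ultimately show "1 + w + w ^ 2 + w ^ 3 + w ^ 4 = 0" using w by simp
qed

definition fps_norm :: "complex fps \<Rightarrow> complex fps" where
  "fps_norm f = f * fps_twist zeta f * fps_twist (zeta ^ 2) f * fps_twist (zeta ^ 3) f * fps_twist (zeta ^ 4) f"

lemma fps_norm_mult: "fps_norm (f * g) = fps_norm f * fps_norm g"
  by (simp add: fps_norm_def fps_twist_mult)

lemma fps_norm_1 [simp]: "fps_norm 1 = 1"
  by (simp add: fps_norm_def)

lemma fps_cong_norm: "fps_cong N f g \<Longrightarrow> fps_cong N (fps_norm f) (fps_norm g)"
  unfolding fps_norm_def by (intro fps_cong_mult fps_cong_twist)

lemma fps_norm_factor:
  "fps_norm (1 - fps_X ^ n) = (if 5 dvd n then (1 - fps_X ^ n) ^ 5 else dil (1 - fps_X ^ n))"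
proof -
  define w :: "complex fps" where "w = fps_const (zeta ^ n)"
  have tw: "fps_twist (zeta ^ j) (1 - fps_X ^ n) = 1 - w ^ j * fps_X ^ n" for j
    by (simp add: fps_twist_diff fps_twist_fps_X_power w_def mult.commute flip: power_mult)
  have eq: "fps_norm (1 - fps_X ^ n) = (1 - fps_X ^ n) * (1 - w * fps_X ^ n) * (1 - w ^ 2 * fps_X ^ n) *
    (1 - w ^ 3 * fps_X ^ n) * (1 - w ^ 4 * fps_X ^ n)"
    unfolding fps_norm_def using tw[of 1] by (simp add: tw)
  show ?thesis
  proof (cases "5 dvd n")
    case True
    then have "w = 1" using zeta_power_eq_1_iff by (simp add: w_def)
    with True show ?thesis by (simp add: eq eval_nat_numeral)
  next
    case False
    then show ?thesis
      unfolding eq norm_fifth_root_linear[OF zeta_power_primitive[OF False, folded w_def]]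
      by (simp add: dil_simps mult.commute flip: power_mult)
  qed
qed

text \<open>The factors with \<open>5 dvd i\<close> give the fifth power. The others are sent to q^5
  and form the full dilated product without its multiples of 5; these are multiplied back on the
  left to avoid a quotient.\<close>

lemma fps_norm_q_pochhammer:
  "fps_norm (q_pochhammer (5 * n)) * dil (dil (q_pochhammer n)) =
    dil (q_pochhammer (5 * n)) * dil (q_pochhammer n) ^ 5"
proof (induction n)
  case (Suc n)
  define f :: "nat \<Rightarrow> complex fps" where "f i = 1 - fps_X ^ i" for i
  have q: "q_pochhammer (5 * Suc n) = q_pochhammer (5 * n) * f (5 * n + 1) * f (5 * n + 2) * f (5 * n + 3)
    * f (5 * n + 4) * f (5 * Suc n)"
    by (simp add: f_def q_pochhammer_Suc eval_nat_numeral del: power_Suc)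
  have q1: "q_pochhammer (Suc n) = q_pochhammer n * f (Suc n)"
    by (simp add: f_def q_pochhammer_Suc del: power_Suc)
  have d: "dil (f i) = f (5 * i)" for i
    by (simp add: f_def dil_simps power_mult)
  have N: "fps_norm (f i) = (if 5 dvd i then f i ^ 5 else dil (f i))" for i
    unfolding f_def by (rule fps_norm_factor)
  have "fps_norm (q_pochhammer (5 * Suc n)) * dil (dil (q_pochhammer (Suc n))) =
    (fps_norm (q_pochhammer (5 * n)) * dil (dil (q_pochhammer n))) *
    (dil (f (5 * n + 1)) * dil (f (5 * n + 2)) * dil (f (5 * n + 3)) * dil (f (5 * n + 4)) *
     f (5 * Suc n) ^ 5 * dil (dil (f (Suc n))))"
  proof -
    have "\<not> 5 dvd 5 * n + 1" "\<not> 5 dvd 5 * n + 2" "\<not> 5 dvd 5 * n + 3" "\<not> 5 dvd 5 * n + 4" "5 dvd 5 * Suc n"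
      by presburger+
    then show ?thesis
      unfolding q q1 fps_norm_mult N dil_mult by (simp only: if_True if_False mult_ac)
  qed
  also have "\<dots> = dil (q_pochhammer (5 * Suc n)) * dil (q_pochhammer (Suc n)) ^ 5"
    unfolding Suc.IH q q1 dil_mult d power_mult_distrib by (simp only: mult_ac)
  finally show ?case .
qed simp

lemma fps_norm_euler_product:
  "fps_norm (cplx euler_product) * cplx (dil (dil euler_product)) = cplx (dil euler_product ^ 6)"
proof (rule fps_eq_if_fps_cong)
  fix N
  let ?E = "cplx euler_product"
  have 1: "fps_cong N ?E (q_pochhammer m)" if "N \<le> m + 1" for m
    unfolding cplx_q_pochhammer[symmetric] by (intro fps_cong_cplx euler_product_cong' that)
  have 5: "fps_cong N ?E (q_pochhammer (5 * N))" by (rule 1) simp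
  have N: "fps_cong N ?E (q_pochhammer N)" by (rule 1) simp
  have "fps_cong N (fps_norm ?E * dil (dil ?E)) (fps_norm (q_pochhammer (5 * N)) * dil (dil (q_pochhammer N)))"
    by (intro fps_cong_mult fps_cong_norm fps_cong_dil N 5)
  also have "\<dots> = dil (q_pochhammer (5 * N)) * dil (q_pochhammer N) ^ 5"
    by (rule fps_norm_q_pochhammer)
  also have "fps_cong N \<dots> (dil ?E * dil ?E ^ 5)"
    by (intro fps_cong_sym[OF fps_cong_mult] fps_cong_power fps_cong_dil N 5)
  also have "dil ?E * dil ?E ^ 5 = cplx (dil euler_product ^ 6)"
    by (simp add: cplx_power cplx_dil flip: power_Suc)
  finally show "fps_cong N (fps_norm ?E * cplx (dil (dil euler_product))) (cplx (dil euler_product ^ 6))"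
    by (simp add: cplx_dil)
qed

text \<open>The norm of Euler's product is computed twice: factor by factor, and from the
  dissection, whose parts are merely multiplied by powers of the root of unity.\<close>

lemma dissection_norm:
  "(euler0 ^ 5 - 11 * e25 ^ 5 + euler2 ^ 5) * dil (dil euler_product) = dil euler_product ^ 6"
proof -
  define w :: "complex fps" where "w = fps_const zeta"
  have tw: "fps_twist (zeta ^ j) (cplx euler_product) = cplx euler0 - w ^ j * cplx e25 + (w ^ j) ^ 2 * cplx euler2" for j
  proof -
    have z: "(zeta ^ j) ^ 5 = 1" by (metis mult.commute power_mult power_one zeta_power_5)
    show ?thesis
      unfolding euler_product_dissection cplx_add cplx_diff fps_twist_add fps_twist_diff
        fps_twist_in_class[OF in_class_cplx[OF in_class_part5] z]
        fps_twist_in_class[OF in_class_cplx[OF in_class_e25] z]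
      by (simp add: w_def)
  qed
  have w: "1 + w + w ^ 2 + w ^ 3 + w ^ 4 = 0" "w ^ 5 = 1"
    using zeta_power_primitive[of 1] by (simp_all add: w_def)
  have w': "w ^ 6 = w" "w ^ 8 = w ^ 3"
    using w(2) power_add[of w 5 1] power_add[of w 5 3] by simp_all
  have "cplx euler0 * cplx euler2 = - (cplx e25 ^ 2)"
    using arg_cong[OF euler0_euler2, of cplx] by (simp add: cplx_mult cplx_power cplx_uminus)
  note norm = norm_fifth_root_quadratic[OF w this]
  have "fps_norm (cplx euler_product) = cplx euler0 ^ 5 - 11 * cplx e25 ^ 5 + cplx euler2 ^ 5"
  proof -
    have E: "cplx euler_product = cplx euler0 - cplx e25 + cplx euler2"
      by (subst euler_product_dissection) (simp add: cplx_add cplx_diff)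
    have tw1: "fps_twist zeta (cplx euler_product) = cplx euler0 - w * cplx e25 + w ^ 2 * cplx euler2"
      using tw[of 1] by simp
    show ?thesis unfolding norm[symmetric] fps_norm_def tw1 tw unfolding E by (simp add: w')
  qed
  then have "fps_norm (cplx euler_product) = cplx (euler0 ^ 5 - 11 * e25 ^ 5 + euler2 ^ 5)"
    by (simp add: cplx_add cplx_diff cplx_mult cplx_power)
  then show ?thesis
    using fps_norm_euler_product by (simp add: cplx_mult[symmetric] cplx_inject)
qed

subsection \<open>Convolution identities for divisor sums\<close>

definition sigma_fps :: "nat \<Rightarrow> int fps" where
  "sigma_fps k = Abs_fps (\<lambda>n. if n = 0 then 0 else int (divisor_sigma k n))"

lemma sigma_fps_nth: "sigma_fps k $ n = (if n = 0 then 0 else int (divisor_sigma k n))"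
  by (simp add: sigma_fps_def)

text \<open>The logarithmic derivative of \<open>1 - q^i\<close> is minus the Lambert series
  \<open>i q^i / (1 - q^i)\<close>, which has the coefficient \<open>i\<close> at the positive
  multiples of \<open>i\<close>.\<close>

lemma fps_XD_q_pochhammer:
  "fps_XD (q_pochhammer N) =
    - (q_pochhammer N * (\<Sum>i\<in>{0<..N}. Abs_fps (\<lambda>n. if 0 < n \<and> i dvd n then int i else 0)))"
proof (induction N)
  case (Suc N)
  let ?L = "\<lambda>i. Abs_fps (\<lambda>n. if 0 < n \<and> i dvd n then int i else 0)"
  have "(1 - fps_X ^ Suc N) * ?L (Suc N) = of_nat (Suc N) * fps_X ^ Suc N"
  proof (rule fps_ext)
    fix n
    have "Suc N dvd n - Suc N \<longleftrightarrow> Suc N dvd n" if "Suc N \<le> n"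
      using that by (metis dvd_diff_nat dvd_refl le_add_diff_inverse dvd_add)
    moreover have "Suc N \<le> n" if "0 < n" "Suc N dvd n" using that by (auto dest: dvd_imp_le)
    ultimately show "((1 - fps_X ^ Suc N) * ?L (Suc N)) $ n = (of_nat (Suc N) * fps_X ^ Suc N) $ n"
      by (auto simp: left_diff_distrib fps_X_power_mult_nth fps_of_nat[symmetric]
               simp del: power_Suc of_nat_Suc)
  qed
  moreover have "fps_XD (1 - fps_X ^ Suc N) = - (of_nat (Suc N) * fps_X ^ Suc N :: int fps)"
    by (auto simp: fps_eq_iff fps_of_nat[symmetric] simp del: power_Suc of_nat_Suc)
  ultimately have f: "fps_XD (1 - fps_X ^ Suc N) = - ((1 - fps_X ^ Suc N) * ?L (Suc N))"
    by simp
  have "{0<..Suc N} = insert (Suc N) {0<..N}" by auto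
  then have s: "(\<Sum>i\<in>{0<..Suc N}. ?L i) = ?L (Suc N) + (\<Sum>i\<in>{0<..N}. ?L i)"
    by simp
  show ?case
    unfolding q_pochhammer_Suc fps_XD_mult Suc.IH f s by (simp add: algebra_simps del: power_Suc)
qed simp

lemma fps_XD_euler_product: "fps_XD euler_product = euler_product * (- sigma_fps 1)"
proof (rule fps_eq_if_fps_cong)
  fix N
  let ?L = "\<lambda>i. Abs_fps (\<lambda>n. if 0 < n \<and> i dvd n then int i else 0)"
  have E: "fps_cong N euler_product (q_pochhammer N)"
    by (rule euler_product_cong') simp
  then have "fps_cong N (fps_XD euler_product) (fps_XD (q_pochhammer N))"
    by (simp add: fps_cong_def)
  also note fps_XD_q_pochhammer
  also have "fps_cong N (- (q_pochhammer N * (\<Sum>i\<in>{0<..N}. ?L i))) (euler_product * (- sigma_fps 1))"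
    unfolding mult_minus_right[symmetric]
  proof (intro fps_cong_mult fps_cong_sym[OF E])
    have "(\<Sum>i\<in>{0<..N}. ?L i $ n) = sigma_fps 1 $ n" if "n < N" for n
    proof (cases "n = 0")
      case False
      have "(\<Sum>i\<in>{0<..N}. ?L i $ n) = (\<Sum>i\<in>{i \<in> {0<..N}. i dvd n}. int i)"
        using False by (subst sum.inter_filter) auto
      also have "{i \<in> {0<..N}. i dvd n} = {i. i dvd n}"
        using False that by (auto dest: dvd_imp_le intro!: Nat.gr0I)
      finally show ?thesis using False by (simp add: sigma_fps_nth divisor_sigma_def)
    qed (simp add: sigma_fps_nth)
    then show "fps_cong N (- (\<Sum>i\<in>{0<..N}. ?L i)) (- sigma_fps 1)"
      by (simp add: fps_cong_def fps_sum_nth)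
  qed
  finally show "fps_cong N (fps_XD euler_product) (euler_product * (- sigma_fps 1))" .
qed

text \<open>The index set of a convolution of two divisor sums: \<open>a\<close> and
  \<open>b\<close> are the divisors, \<open>x\<close> and \<open>y\<close> their codivisors.\<close>

definition quads :: "nat \<Rightarrow> (nat \<times> nat \<times> nat \<times> nat) set" where
  "quads n = {(a, x, b, y). 0 < a \<and> 0 < x \<and> 0 < b \<and> 0 < y \<and> a * x + b * y = n}"

lemma finite_quads [simp]: "finite (quads n)"
proof (rule finite_subset)
  have "a \<le> n \<and> x \<le> n" if "0 < a" "0 < x" "a * x + z = n" for a x z :: nat
  proof -
    have "a \<le> a * x" "x \<le> a * x" using that by auto
    with that show ?thesis by linarith
  qed
  from this this[OF _ _ trans[OF add.commute]]
  show "quads n \<subseteq> {0..n} \<times> {0..n} \<times> {0..n} \<times> {0..n}"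
    unfolding quads_def by auto
qed simp

lemma sigma_fps_mult_nth:
  "(sigma_fps k * sigma_fps l) $ n = (\<Sum>(a, x, b, y)\<in>quads n. int a ^ k * int b ^ l)"
proof -
  have "(sigma_fps k * sigma_fps l) $ n = (\<Sum>i=0..n. sigma_fps k $ i * sigma_fps l $ (n - i))"
    by (rule fps_mult_nth)
  also have "\<dots> = (\<Sum>i\<in>{0<..<n}. sigma_fps k $ i * sigma_fps l $ (n - i))"
    by (rule sum.mono_neutral_right) (auto simp: sigma_fps_nth)
  also have "\<dots> = (\<Sum>i\<in>{0<..<n}. \<Sum>(a, b)\<in>{a. a dvd i} \<times> {b. b dvd n - i}. int a ^ k * int b ^ l)"
    by (intro sum.cong) (auto simp: sigma_fps_nth divisor_sigma_def sum_product sum.cartesian_product)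
  also have "\<dots> = (\<Sum>(i, a, b)\<in>(SIGMA i:{0<..<n}. {a. a dvd i} \<times> {b. b dvd n - i}). int a ^ k * int b ^ l)"
    by (subst sum.Sigma) (auto simp: case_prod_beta)
  also have "\<dots> = (\<Sum>(a, x, b, y)\<in>quads n. int a ^ k * int b ^ l)"
    by (rule sum.reindex_bij_witness[where i = "\<lambda>(a, x, b, y). (a * x, a, b)"
          and j = "\<lambda>(i, a, b). (a, i div a, b, (n - i) div b)"])
       (auto simp: quads_def intro!: Nat.gr0I elim!: dvdE split: if_splits)
  finally show ?thesis .
qed

text \<open>
  Liouville's identity. The three bijections replace \<open>a * x + b * y\<close> by
  \<open>(a - b) * x + b * (x + y)\<close>, by \<open>(a + b) * x + b * (y - x)\<close> and by \<open>a * (x + y) + (b - a) * y\<close>.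
\<close>

lemma liouville:
  fixes F :: "int \<Rightarrow> int"
  assumes even: "\<And>x. F (- x) = F x" and F0: "F 0 = 0" and n: "0 < n"
  shows "(\<Sum>(a, x, b, y)\<in>quads n. F (int a + int b) - F (int a - int b)) =
    (\<Sum>d | d dvd n. (int d + 1 - 2 * int (n div d)) * F (int d) + 2 * (\<Sum>i\<in>{0<..<d}. F (int i)))"
proof -
  define Q where "Q P f = (\<Sum>(a, x, b, y)\<in>{p \<in> quads n. case p of (a, x, b, y) \<Rightarrow> P a x b y}. f a b)"
    for P :: "nat \<Rightarrow> nat \<Rightarrow> nat \<Rightarrow> nat \<Rightarrow> bool" and f :: "nat \<Rightarrow> nat \<Rightarrow> int"
  let ?D = "\<lambda>f. (\<Sum>d | d dvd n. f d :: int)"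
  have fin: "finite {d. d dvd n}" using n by simp
  have Q: "Q P f = (\<Sum>(a, x, b, y)\<in>quads n. if P a x b y then f a b else 0)" for P f
    unfolding Q_def sum.inter_filter[OF finite_quads] by (intro sum.cong) auto
  have split_ab: "(\<Sum>(a, x, b, y)\<in>quads n. f a b) =
    Q (\<lambda>a x b y. a < b) f + Q (\<lambda>a x b y. a = b) f + Q (\<lambda>a x b y. b < a) f" for f
    unfolding Q sum.distrib[symmetric] by (intro sum.cong) auto
  have split_xy: "(\<Sum>(a, x, b, y)\<in>quads n. f a b) =
    Q (\<lambda>a x b y. x < y) f + Q (\<lambda>a x b y. x = y) f + Q (\<lambda>a x b y. y < x) f" for f
    unfolding Q sum.distrib[symmetric] by (intro sum.cong) auto
  let ?F = "\<lambda>a b::nat. F (int a)"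
  have h: "b < a \<Longrightarrow> (a - b) * x + b * (x + y) = a * x + b * y"
    "x < y \<Longrightarrow> (a + b) * x + b * (y - x) = a * x + b * y"
    "a < b \<Longrightarrow> a * (x + y) + (b - a) * y = a * x + b * y"
    "y < x \<Longrightarrow> a * (x - y) + (a + b) * y = a * x + b * y"
    "x < y \<Longrightarrow> a * x + a * (y - x) = a * y" for a b x y :: nat
    by (auto dest!: less_imp_Suc_add simp: algebra_simps)

  have 1: "Q (\<lambda>a x b y. b < a) (\<lambda>a b. F (int a - int b)) = Q (\<lambda>a x b y. x < y) ?F"
    unfolding Q_def
    by (rule sum.reindex_bij_witness[where j = "\<lambda>(a, x, b, y). (a - b, x, b, x + y)"
          and i = "\<lambda>(a, x, b, y). (a + b, x, b, y - x)"])
       (auto simp: quads_def h of_nat_diff)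
  have 2: "Q (\<lambda>a x b y. a < b) (\<lambda>a b. F (int a - int b)) = Q (\<lambda>a x b y. b < a) (\<lambda>a b. F (int a - int b))"
    unfolding Q_def
    by (rule sum.reindex_bij_witness[where j = "\<lambda>(a, x, b, y). (b, y, a, x)"
          and i = "\<lambda>(a, x, b, y). (b, y, a, x)"])
       (auto simp: quads_def, metis even minus_diff_eq)
  have 3: "Q (\<lambda>a x b y. a = b) (\<lambda>a b. F (int a - int b)) = 0"
    unfolding Q_def by (rule sum.neutral) (auto simp: F0)
  have 4: "Q (\<lambda>a x b y. x < y) (\<lambda>a b. F (int a + int b)) = Q (\<lambda>a x b y. b < a) ?F"
    unfolding Q_def
    by (rule sum.reindex_bij_witness[where j = "\<lambda>(a, x, b, y). (a + b, x, b, y - x)"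
          and i = "\<lambda>(a, x, b, y). (a - b, x, b, x + y)"])
       (auto simp: quads_def h of_nat_diff)
  have 5: "Q (\<lambda>a x b y. y < x) (\<lambda>a b. F (int a + int b)) = Q (\<lambda>a x b y. x < y) (\<lambda>a b. F (int a + int b))"
    unfolding Q_def
    by (rule sum.reindex_bij_witness[where j = "\<lambda>(a, x, b, y). (b, y, a, x)"
          and i = "\<lambda>(a, x, b, y). (b, y, a, x)"])
       (auto simp: quads_def add.commute)
  have 6: "Q (\<lambda>a x b y. a < b) ?F = Q (\<lambda>a x b y. y < x) ?F"
    unfolding Q_def
    by (rule sum.reindex_bij_witness[where j = "\<lambda>(a, x, b, y). (a, x + y, b - a, y)"
          and i = "\<lambda>(a, x, b, y). (a, x - y, a + b, y)"])
       (auto simp: quads_def h of_nat_diff)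
  \<comment> \<open>For \<open>x = y\<close> the equation reads \<open>(a + b) x = n\<close>, so
    \<open>d = a + b\<close> runs through the divisors of \<open>n\<close>. For
    \<open>a = b\<close>, in fact \<open>8\<close>, it reads \<open>a (x + y) = n\<close>.\<close>
  have diag_xy: "Q (\<lambda>a x b y. x = y) f = ?D (\<lambda>d. \<Sum>a\<in>{0<..<d}. f a (d - a))" for f
  proof -
    have "?D (\<lambda>d. \<Sum>a\<in>{0<..<d}. f a (d - a)) =
      (\<Sum>(d, a)\<in>(SIGMA d:{d. d dvd n}. {0<..<d}). f a (d - a))"
      by (subst sum.Sigma) (auto simp: fin)
    also have "\<dots> = Q (\<lambda>a x b y. x = y) f"
      unfolding Q_def
      by (rule sum.reindex_bij_witness[where j = "\<lambda>(d, a). (a, n div d, d - a, n div d)"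
            and i = "\<lambda>(a, x, b, y). (a + b, a)"])
         (use n in \<open>auto simp: quads_def simp flip: distrib_right elim!: dvdE\<close>)
    finally show ?thesis ..
  qed
  have 7: "Q (\<lambda>a x b y. x = y) (\<lambda>a b. F (int a + int b)) = ?D (\<lambda>d. (int d - 1) * F (int d))"
    unfolding diag_xy
  proof (intro sum.cong refl)
    fix d assume "d \<in> {d. d dvd n}"
    then have "0 < d" using n by (auto intro!: Nat.gr0I)
    have "(\<Sum>a\<in>{0<..<d}. F (int a + int (d - a))) = (\<Sum>a\<in>{0<..<d}. F (int d))"
      by (intro sum.cong) (auto simp: of_nat_diff)
    also have "\<dots> = (int d - 1) * F (int d)" using \<open>0 < d\<close> by (simp add: of_nat_diff)
    finally show "(\<Sum>a\<in>{0<..<d}. F (int a + int (d - a))) = (int d - 1) * F (int d)" .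
  qed
  have 8: "Q (\<lambda>a x b y. a = b) ?F = ?D (\<lambda>d. (int (n div d) - 1) * F (int d))"
  proof -
    have "?D (\<lambda>d. (int (n div d) - 1) * F (int d)) = ?D (\<lambda>d. \<Sum>x\<in>{0<..<n div d}. F (int d))"
    proof (intro sum.cong refl)
      fix d assume "d \<in> {d. d dvd n}"
      then have "0 < n div d" using n by (auto elim!: dvdE)
      then show "(int (n div d) - 1) * F (int d) = (\<Sum>x\<in>{0<..<n div d}. F (int d))"
        by (simp add: of_nat_diff)
    qed
    also have "\<dots> = (\<Sum>(d, x)\<in>(SIGMA d:{d. d dvd n}. {0<..<n div d}). F (int d))"
      by (subst sum.Sigma) (auto simp: fin)
    also have "\<dots> = Q (\<lambda>a x b y. a = b) ?F"
      unfolding Q_def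
      by (rule sum.reindex_bij_witness[where j = "\<lambda>(d, x). (d, x, d, n div d - x)"
            and i = "\<lambda>(a, x, b, y). (a, x)"])
         (use n in \<open>auto simp: quads_def h elim!: dvdE\<close>)
    finally show ?thesis ..
  qed
  have "(\<Sum>(a, x, b, y)\<in>quads n. F (int a + int b) - F (int a - int b)) =
    (\<Sum>(a, x, b, y)\<in>quads n. F (int a + int b)) - (\<Sum>(a, x, b, y)\<in>quads n. F (int a - int b))"
    by (simp add: case_prod_beta sum_subtractf)
  also have "\<dots> = ?D (\<lambda>d. (int d - 1) * F (int d)) +
    2 * Q (\<lambda>a x b y. b < a) ?F - 2 * Q (\<lambda>a x b y. x < y) ?F"
    using split_ab[of "\<lambda>a b. F (int a - int b)"] split_xy[of "\<lambda>a b. F (int a + int b)"] 1 2 3 4 5 7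
    by simp
  \<comment> \<open>The off-diagonal sums are never evaluated. Splitting the same total by
    \<open>a\<close> against \<open>b\<close> and by \<open>x\<close> against \<open>y\<close>, with
    \<open>6\<close> cancelling one part, expresses their difference by the two diagonals.\<close>
  also have "Q (\<lambda>a x b y. b < a) ?F - Q (\<lambda>a x b y. x < y) ?F =
    ?D (\<lambda>d. \<Sum>a\<in>{0<..<d}. F (int a)) - ?D (\<lambda>d. (int (n div d) - 1) * F (int d))"
    using split_ab[of ?F] split_xy[of ?F] 6 8 diag_xy[of ?F] by simp
  then have "?D (\<lambda>d. (int d - 1) * F (int d)) +
    2 * Q (\<lambda>a x b y. b < a) ?F - 2 * Q (\<lambda>a x b y. x < y) ?F =
    ?D (\<lambda>d. (int d - 1) * F (int d)) +
    2 * (?D (\<lambda>d. \<Sum>a\<in>{0<..<d}. F (int a)) - ?D (\<lambda>d. (int (n div d) - 1) * F (int d)))"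
    by simp
  also have "\<dots> = ?D (\<lambda>d. (int d + 1 - 2 * int (n div d)) * F (int d) + 2 * (\<Sum>i\<in>{0<..<d}. F (int i)))"
    unfolding sum_subtractf[symmetric] sum_distrib_left[where A = "{d. d dvd n}"] sum.distrib[symmetric]
    by (intro sum.cong) (auto simp: algebra_simps)
  finally show ?thesis .
qed

lemma sum_squares: "6 * (\<Sum>i\<in>{0<..<d}. int i ^ 2) = 2 * int d ^ 3 - 3 * int d ^ 2 + int d"
proof (induction d)
  case (Suc d)
  have "{0<..<Suc d} = (if d = 0 then {} else insert d {0<..<d})" by auto
  then have "(\<Sum>i\<in>{0<..<Suc d}. int i ^ 2) = (\<Sum>i\<in>{0<..<d}. int i ^ 2) + int d ^ 2" by simp
  then show ?case using Suc by (simp add: eval_nat_numeral algebra_simps)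
qed simp

lemma sum_fourth_powers:
  "30 * (\<Sum>i\<in>{0<..<d}. int i ^ 4) = 6 * int d ^ 5 - 15 * int d ^ 4 + 10 * int d ^ 3 - int d"
proof (induction d)
  case (Suc d)
  have "{0<..<Suc d} = (if d = 0 then {} else insert d {0<..<d})" by auto
  then have "(\<Sum>i\<in>{0<..<Suc d}. int i ^ 4) = (\<Sum>i\<in>{0<..<d}. int i ^ 4) + int d ^ 4" by simp
  then show ?case using Suc by (simp add: eval_nat_numeral algebra_simps)
qed simp

lemma int_divisor_sigma: "int (divisor_sigma k n) = (\<Sum>d | d dvd n. int d ^ k)"
  by (simp add: divisor_sigma_def)

lemma div_mult_power:
  assumes "d dvd n" "m = Suc k"
  shows "int (n div d) * int d ^ m = int n * int d ^ k"
proof -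
  have "int (n div d) * int d = int n" using assms(1) by (metis dvd_div_mult_self of_nat_mult)
  then show ?thesis by (simp add: assms(2) mult.assoc[symmetric])
qed

text \<open>Liouville's identity with \<open>F x = x ^ 2\<close>, where the difference is
  \<open>4ab\<close>. The terms \<open>(n / d) d^2 = n d\<close> produce the derivative.\<close>

lemma sigma_convolution_1_1: "12 * (sigma_fps 1)\<^sup>2 = 5 * sigma_fps 3 - 6 * fps_XD (sigma_fps 1) + sigma_fps 1"
proof (rule fps_ext)
  fix n
  show "(12 * (sigma_fps 1)\<^sup>2) $ n = (5 * sigma_fps 3 - 6 * fps_XD (sigma_fps 1) + sigma_fps 1) $ n"
  proof (cases "n = 0")
    case False
    have "4 * (sigma_fps 1 * sigma_fps 1) $ n =
      (\<Sum>(a, x, b, y)\<in>quads n. (int a + int b) ^ 2 - (int a - int b) ^ 2)"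
      unfolding sigma_fps_mult_nth sum_distrib_left
      by (intro sum.cong) (auto simp: power2_eq_square algebra_simps)
    also have "\<dots> = (\<Sum>d | d dvd n. (int d + 1 - 2 * int (n div d)) * int d ^ 2 + 2 * (\<Sum>i\<in>{0<..<d}. int i ^ 2))"
      using False by (intro liouville) auto
    finally have "12 * (sigma_fps 1 * sigma_fps 1) $ n =
      3 * (\<Sum>d | d dvd n. (int d + 1 - 2 * int (n div d)) * int d ^ 2 + 2 * (\<Sum>i\<in>{0<..<d}. int i ^ 2))"
      by simp
    also have "\<dots> = (\<Sum>d | d dvd n. 3 * ((int d + 1 - 2 * int (n div d)) * int d ^ 2)
      + 6 * (\<Sum>i\<in>{0<..<d}. int i ^ 2))"
      by (subst sum_distrib_left) (rule sum.cong[OF refl], algebra)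
    also have "\<dots> = (\<Sum>d | d dvd n. 5 * int d ^ 3 - 6 * (int n * int d ^ 1) + int d ^ 1)"
      unfolding sum_squares
    proof (intro sum.cong refl)
      fix d assume "d \<in> {d. d dvd n}"
      then have *: "int (n div d) * int d ^ 2 = int n * int d ^ 1"
        by (intro div_mult_power) auto
      have "3 * ((int d + 1 - 2 * int (n div d)) * int d ^ 2) =
        3 * int d ^ 3 + 3 * int d ^ 2 - 6 * (int (n div d) * int d ^ 2)"
        by (simp add: algebra_simps eval_nat_numeral)
      then show "3 * ((int d + 1 - 2 * int (n div d)) * int d ^ 2) + (2 * int d ^ 3 - 3 * int d ^ 2 + int d) =
        5 * int d ^ 3 - 6 * (int n * int d ^ 1) + int d ^ 1"
        unfolding * by simp
    qed
    also have "\<dots> = 5 * int (divisor_sigma 3 n) - 6 * (int n * int (divisor_sigma 1 n)) + int (divisor_sigma 1 n)"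
      unfolding int_divisor_sigma by (simp add: sum.distrib sum_subtractf sum_distrib_left)
    finally show ?thesis
      using False by (simp add: power2_eq_square sigma_fps_nth numeral_fps_const)
  qed (simp add: sigma_fps_nth)
qed

text \<open>Liouville's identity with \<open>F x = x ^ 4\<close>, where the difference is
  \<open>8 a^3 b + 8 a b^3\<close> and both summands yield the same convolution.\<close>

lemma sigma_convolution_3_1:
  "240 * (sigma_fps 3 * sigma_fps 1) =
    21 * sigma_fps 5 - 30 * fps_XD (sigma_fps 3) + 10 * sigma_fps 3 - sigma_fps 1"
proof (rule fps_ext)
  fix n
  show "(240 * (sigma_fps 3 * sigma_fps 1)) $ n =
    (21 * sigma_fps 5 - 30 * fps_XD (sigma_fps 3) + 10 * sigma_fps 3 - sigma_fps 1) $ n"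
  proof (cases "n = 0")
    case False
    have "16 * (sigma_fps 3 * sigma_fps 1) $ n =
      8 * (sigma_fps 3 * sigma_fps 1) $ n + 8 * (sigma_fps 1 * sigma_fps 3) $ n"
      by (subst mult.commute[of "sigma_fps 1"]) simp
    also have "\<dots> = (\<Sum>(a, x, b, y)\<in>quads n. (int a + int b) ^ 4 - (int a - int b) ^ 4)"
      unfolding sigma_fps_mult_nth sum_distrib_left sum.distrib[symmetric]
      by (intro sum.cong) (auto simp: eval_nat_numeral algebra_simps)
    also have "\<dots> = (\<Sum>d | d dvd n. (int d + 1 - 2 * int (n div d)) * int d ^ 4 + 2 * (\<Sum>i\<in>{0<..<d}. int i ^ 4))"
      using False by (intro liouville) auto
    finally have "240 * (sigma_fps 3 * sigma_fps 1) $ n =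
      15 * (\<Sum>d | d dvd n. (int d + 1 - 2 * int (n div d)) * int d ^ 4 + 2 * (\<Sum>i\<in>{0<..<d}. int i ^ 4))"
      by simp
    also have "\<dots> =
      (\<Sum>d | d dvd n. 15 * ((int d + 1 - 2 * int (n div d)) * int d ^ 4) + 30 * (\<Sum>i\<in>{0<..<d}. int i ^ 4))"
      by (subst sum_distrib_left) (rule sum.cong[OF refl], algebra)
    also have "\<dots> = (\<Sum>d | d dvd n. 21 * int d ^ 5 - 30 * (int n * int d ^ 3) + 10 * int d ^ 3 - int d ^ 1)"
      unfolding sum_fourth_powers
    proof (intro sum.cong refl)
      fix d assume "d \<in> {d. d dvd n}"
      then have *: "int (n div d) * int d ^ 4 = int n * int d ^ 3"
        by (intro div_mult_power) auto
      have "15 * ((int d + 1 - 2 * int (n div d)) * int d ^ 4) =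
        15 * int d ^ 5 + 15 * int d ^ 4 - 30 * (int (n div d) * int d ^ 4)"
        by (simp add: algebra_simps eval_nat_numeral)
      then show "15 * ((int d + 1 - 2 * int (n div d)) * int d ^ 4) +
        (6 * int d ^ 5 - 15 * int d ^ 4 + 10 * int d ^ 3 - int d) =
        21 * int d ^ 5 - 30 * (int n * int d ^ 3) + 10 * int d ^ 3 - int d ^ 1"
        unfolding * by simp
    qed
    also have "\<dots> = 21 * int (divisor_sigma 5 n) - 30 * (int n * int (divisor_sigma 3 n))
      + 10 * int (divisor_sigma 3 n) - int (divisor_sigma 1 n)"
      unfolding int_divisor_sigma by (simp add: sum.distrib sum_subtractf sum_distrib_left)
    finally show ?thesis
      using False by (simp add: sigma_fps_nth numeral_fps_const)
  qed (simp add: sigma_fps_nth)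
qed

section \<open>Ramanujan's differential equations\<close>

definition E2_fps :: "int fps" where
  "E2_fps = 1 - 24 * sigma_fps 1"

definition E4_fps :: "int fps" where
  "E4_fps = 1 + 240 * sigma_fps 3"

lemma fps_XD_numeral_mult: "fps_XD (numeral k * f) = numeral k * fps_XD (f :: 'a::comm_ring_1 fps)"
  by (simp add: fps_XD_mult)

lemma ramanujan_E4: "E4_fps = E2_fps\<^sup>2 - 12 * fps_XD E2_fps"
proof -
  have XD: "fps_XD E2_fps = - 24 * fps_XD (sigma_fps 1)"
    by (simp add: E2_fps_def fps_XD_diff fps_XD_numeral_mult)
  have "E2_fps\<^sup>2 - 12 * fps_XD E2_fps = 1 - 48 * sigma_fps 1 + 48 * (12 * (sigma_fps 1)\<^sup>2) + 288 * fps_XD (sigma_fps 1)"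
    unfolding XD by (simp add: E2_fps_def power2_eq_square algebra_simps)
  then show ?thesis unfolding sigma_convolution_1_1 E4_fps_def by (simp add: algebra_simps)
qed

lemma ramanujan_E6: "E6_fps = E2_fps * E4_fps - 3 * fps_XD E4_fps"
proof -
  have "E6_fps = 1 - 504 * sigma_fps 5"
    by (simp add: fps_eq_iff E6_fps_def sigma_fps_nth numeral_fps_const)
  moreover have "fps_XD E4_fps = 240 * fps_XD (sigma_fps 3)"
    by (simp add: E4_fps_def fps_XD_numeral_mult)
  then have "E2_fps * E4_fps - 3 * fps_XD E4_fps = 1 - 24 * sigma_fps 1 + 240 * sigma_fps 3
    - 24 * (240 * (sigma_fps 3 * sigma_fps 1)) - 720 * fps_XD (sigma_fps 3)"
    by (simp add: E2_fps_def E4_fps_def algebra_simps)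
  then have "E2_fps * E4_fps - 3 * fps_XD E4_fps = 1 - 504 * sigma_fps 5"
    unfolding sigma_convolution_3_1 by (simp add: algebra_simps)
  ultimately show ?thesis by simp
qed

subsection \<open>Modular functions of level 5\<close>

abbreviation inv_euler :: "int fps" where
  "inv_euler \<equiv> fps_right_inverse euler_product 1"

definition zf :: "int fps" where
  "zf = e25 * inv_euler"

definition tf :: "int fps" where
  "tf = fps_X * dil euler_product ^ 6 * inv_euler ^ 6"

definition af :: "int fps" where
  "af = euler_product ^ 5 * dil inv_euler"

text \<open>\<open>(5 E2(q^5) - E2(q)) / 4\<close> with the division carried out:
  \<open>6 = 24 / 4\<close> and \<open>30 = 5 * 24 / 4\<close>.\<close>

definition Sf :: "int fps" where
  "Sf = 1 + 6 * sigma_fps 1 - 30 * dil (sigma_fps 1)"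

text \<open>The quartic of the modular equation. It equals \<open>tf / zf\<close>,
  \<open>zf ^ 5 / dil tf\<close> and \<open>dil af / af\<close>, so it translates between q and
  q^5.\<close>

definition Df :: "int fps" where
  "Df = 1 + 5 * zf + 15 * zf ^ 2 + 25 * zf ^ 3 + 25 * zf ^ 4"

lemma inv_euler: "euler_product * inv_euler = 1"
  by (rule fps_right_inverse) simp

lemma dil_inv_euler: "dil euler_product * dil inv_euler = 1"
  using arg_cong[OF inv_euler, of dil] by (simp add: dil_mult)

lemma dil_dil_inv_euler: "dil (dil euler_product) * dil (dil inv_euler) = 1"
  using arg_cong[OF dil_inv_euler, of dil] by (simp add: dil_mult)

lemma dil_nonzero: "f $ 0 \<noteq> 0 \<Longrightarrow> dil f \<noteq> 0"
  by (metis dil_nth_0 fps_zero_nth)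

lemma inv_euler_nth_0 [simp]: "inv_euler $ 0 = 1"
  using arg_cong[OF inv_euler, of "\<lambda>f. f $ 0"] by simp

lemma inv_euler_nonzero [simp]: "inv_euler \<noteq> 0"
  by (metis inv_euler_nth_0 fps_zero_nth zero_neq_one)

lemma e25_nonzero [simp]: "e25 \<noteq> 0"
  by (simp add: e25_def dil_nonzero)

lemma tf_nonzero [simp]: "tf \<noteq> 0"
  by (simp add: tf_def dil_nonzero)

lemma dil_tf: "dil tf = fps_X ^ 5 * dil (dil euler_product) ^ 6 * dil inv_euler ^ 6"
  by (simp add: tf_def dil_simps)

lemma dil_tf_nonzero [simp]: "dil tf \<noteq> 0"
  by (simp add: dil_tf dil_nonzero)

lemma zf_nonzero [simp]: "zf \<noteq> 0"
  by (simp add: zf_def)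

lemma euler_product_zf: "euler_product * zf = e25"
  using inv_euler by (simp add: zf_def mult.left_commute)

lemma zf_nth_0 [simp]: "zf $ 0 = 0"
  by (simp add: zf_def e25_def)

lemma Df_nth_0 [simp]: "Df $ 0 = 1"
  by (simp add: Df_def fps_power_zeroth)

lemma Df_nonzero [simp]: "Df \<noteq> 0"
  by (metis Df_nth_0 fps_zero_nth zero_neq_one)

lemma Sf_nth_0 [simp]: "Sf $ 0 = 1"
  by (simp add: Sf_def sigma_fps_nth)

lemma af_nth_0 [simp]: "af $ 0 = 1"
  by (simp add: af_def fps_power_zeroth)

lemma tf_nth_0 [simp]: "tf $ 0 = 0"
  by (simp add: tf_def fps_power_zeroth)

lemma Sf_nonzero [simp]: "Sf \<noteq> 0"
  by (metis Sf_nth_0 fps_zero_nth zero_neq_one)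

lemma af_nonzero [simp]: "af \<noteq> 0"
  by (metis af_nth_0 fps_zero_nth zero_neq_one)

text \<open>By the dissection \<open>euler0\<close> and \<open>euler2\<close> have the sum
  \<open>euler_product + e25\<close> and the product \<open>- e25 ^ 2\<close>. Hence the symmetric
  left side of \<open>dissection_norm\<close> is a polynomial in \<open>euler_product\<close> and
  \<open>e25\<close>; division by \<open>euler_product ^ 5\<close> turns it into
  \<open>Df\<close>.\<close>

lemma zf_power_5: "zf ^ 5 = dil tf * Df"
proof -
  let ?K = "euler0 ^ 5 - 11 * e25 ^ 5 + euler2 ^ 5"
  let ?E5 = "dil euler_product" and ?E25 = "dil (dil euler_product)" and ?E = euler_product
  have K: "?E ^ 5 + 5 * ?E ^ 4 * e25 + 15 * ?E ^ 3 * e25 ^ 2 + 25 * ?E ^ 2 * e25 ^ 3 + 25 * ?E * e25 ^ 4 = ?K"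
    using euler0_euler2 euler_product_dissection by algebra
  have "dil tf * ?E5 ^ 6 = fps_X ^ 5 * ?E25 ^ 6 * (?E5 * dil inv_euler) ^ 6"
    unfolding dil_tf by (simp add: power_mult_distrib mult_ac)
  then have T: "dil tf * ?E5 ^ 6 = fps_X ^ 5 * ?E25 ^ 6"
    unfolding dil_inv_euler by simp
  have "?E25 * (dil tf * ?K) = dil tf * ?E5 ^ 6"
    using dissection_norm by (simp add: mult_ac)
  also have "\<dots> = ?E25 * e25 ^ 5"
    unfolding T e25_def by algebra
  finally have "dil tf * ?K = e25 ^ 5"
    by (simp add: dil_nonzero)
  then have "?E ^ 5 * zf ^ 5 = ?E ^ 5 * (dil tf * Df)"
    unfolding K[symmetric] unfolding Df_def euler_product_zf[symmetric] by algebra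
  then show ?thesis by simp
qed

text \<open>The powers of E(q^5) cancel. In \<open>hecke_U_monom\<close> this trades
  \<open>tf ^ i\<close> for \<open>zf ^ (6 * i)\<close>.\<close>

lemma tf_dil_tf: "tf * dil tf = zf ^ 6"
proof -
  have "tf * dil tf = (dil euler_product * dil inv_euler) ^ 6 * (fps_X * dil (dil euler_product) * inv_euler) ^ 6"
    unfolding dil_tf unfolding tf_def by algebra
  then show ?thesis unfolding dil_inv_euler by (simp add: zf_def e25_def)
qed

lemma tf_eq: "tf = zf * Df"
proof -
  have "dil tf * tf = zf * zf ^ 5"
    using tf_dil_tf by (simp add: mult.commute flip: power_Suc)
  also have "\<dots> = dil tf * (zf * Df)" unfolding zf_power_5 by (simp add: mult_ac)
  finally show ?thesis by simp
qed

lemma af_Df: "af * Df = dil af"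
proof -
  have "dil tf * (af * Df) = af * zf ^ 5"
    unfolding zf_power_5 by (simp add: mult_ac)
  also have "\<dots> = (euler_product * inv_euler) ^ 5 * (dil inv_euler * e25 ^ 5)"
    by (simp add: af_def zf_def power_mult_distrib mult_ac)
  also have "\<dots> = dil inv_euler * e25 ^ 5" unfolding inv_euler by simp
  also have "\<dots> = (dil euler_product * dil inv_euler) ^ 5 * (dil (dil euler_product) * dil (dil inv_euler)) *
      dil inv_euler * e25 ^ 5"
    unfolding dil_inv_euler dil_dil_inv_euler by simp
  also have "\<dots> = dil tf * dil af"
    unfolding dil_tf af_def dil_simps e25_def by algebra
  finally show ?thesis by simp
qed

lemma fps_XD_mult_logarithmic:
  fixes f g u v :: "'a::comm_ring_1 fps"
  assumes "fps_XD f = f * u" "fps_XD g = g * v"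
  shows "fps_XD (f * g) = f * g * (u + v)"
  by (simp add: fps_XD_mult assms algebra_simps)

lemma fps_XD_dil_logarithmic:
  assumes "fps_XD f = f * u"
  shows "fps_XD (dil f) = dil f * (5 * dil u)"
  by (simp add: fps_XD_dil assms dil_mult mult_ac)

lemma fps_XD_inv_euler: "fps_XD inv_euler = inv_euler * sigma_fps 1"
proof -
  have "0 = fps_XD (euler_product * inv_euler)" by (simp add: inv_euler)
  also have "\<dots> = euler_product * (fps_XD inv_euler - inv_euler * sigma_fps 1)"
    unfolding fps_XD_mult fps_XD_euler_product by (simp add: algebra_simps)
  finally show ?thesis by simp
qed

lemma fps_XD_e25: "fps_XD e25 = e25 * (1 - 25 * dil (dil (sigma_fps 1)))"
proof -
  have "fps_XD fps_X = fps_X * (1 :: int fps)" by simp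
  from fps_XD_mult_logarithmic[OF this fps_XD_dil_logarithmic[OF fps_XD_dil_logarithmic[OF fps_XD_euler_product]]]
  show ?thesis by (simp add: e25_def dil_simps)
qed

definition zlog :: "int fps" where
  "zlog = 1 - 25 * dil (dil (sigma_fps 1)) + sigma_fps 1"

lemma fps_XD_zf: "fps_XD zf = zf * zlog"
  unfolding zf_def zlog_def by (rule fps_XD_mult_logarithmic[OF fps_XD_e25 fps_XD_inv_euler])

lemma fps_XD_tf: "fps_XD tf = tf * Sf"
proof -
  have "fps_XD fps_X = fps_X * (1 :: int fps)" by simp
  from fps_XD_mult_logarithmic[OF fps_XD_mult_logarithmic[OF this
      fps_XD_power_logarithmic[OF fps_XD_dil_logarithmic[OF fps_XD_euler_product], of 6]]
      fps_XD_power_logarithmic[OF fps_XD_inv_euler, of 6]]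
  show ?thesis by (simp add: tf_def Sf_def dil_simps algebra_simps)
qed

lemma fps_XD_af: "fps_XD af = af * (5 * dil (sigma_fps 1) - 5 * sigma_fps 1)"
  using fps_XD_mult_logarithmic[OF fps_XD_power_logarithmic[OF fps_XD_euler_product, of 5]
      fps_XD_dil_logarithmic[OF fps_XD_inv_euler]]
  by (simp add: af_def algebra_simps)

lemma fps_XD_dil_tf: "fps_XD (dil tf) = dil tf * (5 * dil Sf)"
  by (rule fps_XD_dil_logarithmic[OF fps_XD_tf])

lemma Sf_eq: "Sf = 6 * zlog - 5 * dil Sf"
  by (simp add: Sf_def zlog_def dil_simps algebra_simps)

text \<open>The logarithmic derivative of the modular equation relates \<open>zlog\<close> to
  \<open>dil Sf\<close>; then \<open>Sf_eq\<close> eliminates \<open>zlog\<close>.\<close>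

lemma Sf_dil_Sf:
  "(1 + 4 * zf + 9 * zf ^ 2 + 10 * zf ^ 3 + 5 * zf ^ 4) * Sf =
   (1 + 10 * zf + 45 * zf ^ 2 + 100 * zf ^ 3 + 125 * zf ^ 4) * dil Sf"
proof -
  have z: "fps_XD (zf ^ k) = zf ^ k * (of_nat k * zlog)" for k
    by (rule fps_XD_power_logarithmic[OF fps_XD_zf])
  have "fps_XD Df = 5 * zf * zlog + 30 * zf ^ 2 * zlog + 75 * zf ^ 3 * zlog + 100 * zf ^ 4 * zlog"
    by (simp add: Df_def fps_XD_numeral_mult fps_XD_zf z)
  then have "zf ^ 5 * (5 * zlog) = dil tf * (5 * dil Sf) * Df +
      dil tf * (5 * zf * zlog + 30 * zf ^ 2 * zlog + 75 * zf ^ 3 * zlog + 100 * zf ^ 4 * zlog)"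
    using z[of 5] zf_power_5 by (simp add: fps_XD_mult fps_XD_dil_tf)
  then have "(dil tf * 5) * ((1 + 4 * zf + 9 * zf ^ 2 + 10 * zf ^ 3 + 5 * zf ^ 4) * zlog) = (dil tf * 5) * (dil Sf * Df)"
    unfolding zf_power_5 Df_def by algebra
  moreover have "dil tf * 5 \<noteq> 0" by simp
  ultimately have "(1 + 4 * zf + 9 * zf ^ 2 + 10 * zf ^ 3 + 5 * zf ^ 4) * zlog = dil Sf * Df"
    using mult_left_cancel by blast
  then show ?thesis using Sf_eq unfolding Df_def by algebra
qed

lemma Sf_square: "Sf ^ 2 = af ^ 2 + 22 * af * (af * tf) + 125 * (af * tf) ^ 2"
proof -
  define N where "N = 1 + 4 * zf + 9 * zf ^ 2 + 10 * zf ^ 3 + 5 * zf ^ 4"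
  define H where "H = 1 + 10 * zf + 45 * zf ^ 2 + 100 * zf ^ 3 + 125 * zf ^ 4"
  define R where "R = Sf ^ 2 - (af ^ 2 + 22 * af * (af * tf) + 125 * (af * tf) ^ 2)"
  \<comment> \<open>With \<open>tf = zf * Df\<close> and \<open>dil tf * Df = zf ^ 5\<close> this
    says that \<open>1 + 22t + 125t^2\<close> changes by the square of \<open>N * Df / H\<close>
    when q becomes q^5. It is a polynomial identity in \<open>zf\<close> alone.\<close>
  have NH: "N ^ 2 * (1 + 22 * (zf * Df) + 125 * (zf * Df) ^ 2) =
      H ^ 2 * (Df ^ 2 + 22 * zf ^ 5 * Df + 125 * zf ^ 10)"
    unfolding N_def H_def Df_def by algebra
  have NS: "N * Sf = H * dil Sf" unfolding N_def H_def by (rule Sf_dil_Sf)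
  have 1: "N ^ 2 * (af ^ 2 + 22 * af * (af * tf) + 125 * (af * tf) ^ 2) =
    af ^ 2 * (N ^ 2 * (1 + 22 * (zf * Df) + 125 * (zf * Df) ^ 2))"
    unfolding tf_eq by algebra
  have 2: "H ^ 2 * (dil af ^ 2 + 22 * dil af * (dil af * dil tf) + 125 * (dil af * dil tf) ^ 2) =
    af ^ 2 * (H ^ 2 * (Df ^ 2 + 22 * zf ^ 5 * Df + 125 * zf ^ 10))"
  proof -
    have "zf ^ 10 = (zf ^ 5) ^ 2" by (simp flip: power_mult)
    then show ?thesis unfolding af_Df[symmetric] zf_power_5 by algebra
  qed
  have "N ^ 2 * R = H ^ 2 * dil R"
    unfolding R_def dil_simps dil_numeral right_diff_distrib 1 2 NH using NS by algebra
  moreover have "(N ^ 2) $ 0 \<noteq> 0" "R $ 0 = 0"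
    by (simp_all add: N_def R_def fps_power_zeroth)
  ultimately have "R = 0" by (rule eq_0_if_mult_eq_mult_dil)
  then show ?thesis by (simp add: R_def)
qed

text \<open>Differentiate \<open>Sf_square\<close> and cancel \<open>2 * Sf\<close>;
  \<open>E2_fps\<close> enters through the derivative of \<open>af\<close>.\<close>

lemma fps_XD_Sf: "6 * fps_XD Sf = (E2_fps - Sf) * Sf + 66 * af * (af * tf) + 750 * (af * tf) ^ 2"
proof -
  define b where "b = af * tf"
  have a: "6 * fps_XD af = (E2_fps - Sf) * af"
    by (simp add: fps_XD_af E2_fps_def Sf_def algebra_simps)
  have b: "fps_XD b = fps_XD af * tf + b * Sf"
    by (simp add: b_def fps_XD_mult fps_XD_tf algebra_simps)
  have "fps_XD (Sf * Sf) = fps_XD (af * af + 22 * (af * b) + 125 * (b * b))"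
    using Sf_square by (simp add: b_def power2_eq_square mult.assoc)
  then have "2 * Sf * fps_XD Sf = 2 * af * fps_XD af + 22 * (af * fps_XD b + b * fps_XD af) + 250 * b * fps_XD b"
    by (simp add: fps_XD_mult fps_XD_numeral_mult algebra_simps)
  then have "(2 * Sf) * (6 * fps_XD Sf) = (2 * Sf) * ((E2_fps - Sf) * Sf + 66 * af * b + 750 * b ^ 2)"
    using a b Sf_square[folded b_def] b_def by algebra
  moreover have "2 * Sf \<noteq> 0" by simp
  ultimately show ?thesis unfolding b_def using mult_left_cancel by blast
qed

text \<open>\<open>ramanujan_E4\<close> at q and at q^5, with E2(q^5) eliminated by
  \<open>P\<close>, expresses \<open>E4_fps - 25 * dil E4_fps\<close> by \<open>af\<close> and
  \<open>b\<close>. The quadratic form on the right has the same difference, so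
  \<open>R = 25 * dil R\<close>.\<close>

lemma E4_fps_eq: "E4_fps = af ^ 2 + 250 * af * (af * tf) + 3125 * (af * tf) ^ 2"
proof -
  define b where "b = af * tf"
  define R where "R = E4_fps - (af ^ 2 + 250 * af * b + 3125 * b ^ 2)"
  have P: "5 * dil E2_fps = E2_fps + 4 * Sf"
    by (simp add: E2_fps_def Sf_def dil_simps algebra_simps)
  have "5 * fps_XD (dil E2_fps) = fps_XD E2_fps + 4 * fps_XD Sf"
    using arg_cong[OF P, of fps_XD] by (simp add: fps_XD_numeral_mult)
  then have X: "25 * dil (fps_XD E2_fps) = fps_XD E2_fps + 4 * fps_XD Sf"
    by (simp add: fps_XD_dil)
  have "dil E4_fps = dil E2_fps ^ 2 - 12 * dil (fps_XD E2_fps)"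
    unfolding ramanujan_E4 by (simp add: dil_simps)
  then have 1: "25 * dil E4_fps = E4_fps + 24 * af ^ 2 - 3000 * b ^ 2"
    using P X ramanujan_E4 fps_XD_Sf[folded b_def] Sf_square[folded b_def] by algebra
  have "25 * (Df ^ 2 + 250 * zf ^ 5 * Df + 3125 * zf ^ 10) =
      25 + 250 * (zf * Df) + 125 * (zf * Df) ^ 2"
    unfolding Df_def by algebra
  moreover have "25 * (dil af ^ 2 + 250 * dil af * dil b + 3125 * dil b ^ 2) =
    af ^ 2 * (25 * (Df ^ 2 + 250 * zf ^ 5 * Df + 3125 * zf ^ 10))"
  proof -
    have "zf ^ 10 = (zf ^ 5) ^ 2" by (simp flip: power_mult)
    then show ?thesis unfolding b_def dil_mult af_Df[symmetric] zf_power_5 by algebra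
  qed
  ultimately have 2: "25 * (dil af ^ 2 + 250 * dil af * dil b + 3125 * dil b ^ 2) =
      25 * af ^ 2 + 250 * af * b + 125 * b ^ 2"
    unfolding b_def tf_eq by algebra
  have "1 * R = 25 * dil R"
    unfolding R_def dil_simps dil_numeral using 1 2 by algebra
  moreover have "R $ 0 = 0"
    by (simp add: R_def b_def E4_fps_def sigma_fps_nth fps_power_zeroth)
  ultimately have "R = 0" by (intro eq_0_if_mult_eq_mult_dil[of 1 R 25]) auto
  then show ?thesis by (simp add: R_def b_def)
qed

text \<open>The form for \<open>E4_fps\<close> is homogeneous of degree 2 in \<open>af\<close> and
  \<open>b\<close>, so all \<open>E2_fps\<close> cancel in \<open>ramanujan_E6\<close>. The
  coefficient of \<open>tf ^ j\<close> is multiplied by \<open>1 - 3j\<close>: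
  \<open>-500 = -2 * 250\<close> and \<open>-15625 = -5 * 3125\<close>.\<close>

lemma E6_fps_eq: "E6_fps = Sf * af ^ 2 * (1 - 500 * tf - 15625 * tf ^ 2)"
proof -
  define b where "b = af * tf"
  have a: "6 * fps_XD af = (E2_fps - Sf) * af"
    by (simp add: fps_XD_af E2_fps_def Sf_def algebra_simps)
  have b: "fps_XD b = fps_XD af * tf + b * Sf"
    by (simp add: b_def fps_XD_mult fps_XD_tf algebra_simps)
  have "fps_XD E4_fps = fps_XD (af * af + 250 * (af * b) + 3125 * (b * b))"
    using E4_fps_eq by (simp add: b_def power2_eq_square mult.assoc)
  then have "fps_XD E4_fps = 2 * af * fps_XD af + 250 * (af * fps_XD b + b * fps_XD af) + 6250 * b * fps_XD b"
    by (simp add: fps_XD_mult fps_XD_numeral_mult algebra_simps)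
  then show ?thesis
    using ramanujan_E6 E4_fps_eq[folded b_def] a b b_def by algebra
qed

subsection \<open>The action of the Hecke operator\<close>

lemma hecke_U_euler0_e25: "0 < k \<Longrightarrow> k < 5 \<Longrightarrow> hecke_U (euler0 ^ k * e25 ^ (5 - k)) = 0"
proof -
  assume k: "0 < k" "k < 5"
  have "in_class (k * 0 + (5 - k) * 1) (euler0 ^ k * e25 ^ (5 - k))"
    by (intro in_class_mult in_class_power in_class_part5 in_class_e25)
  then show ?thesis by (rule hecke_U_eq_0) (use k in presburger)
qed

lemma hecke_U_euler2_e25: "0 < k \<Longrightarrow> k < 5 \<Longrightarrow> hecke_U (euler2 ^ k * e25 ^ (5 - k)) = 0"
proof -
  assume k: "0 < k" "k < 5"
  have "in_class (k * 2 + (5 - k) * 1) (euler2 ^ k * e25 ^ (5 - k))"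
    by (intro in_class_mult in_class_power in_class_part5 in_class_e25)
  then show ?thesis by (rule hecke_U_eq_0) (use k in presburger)
qed

text \<open>Once \<open>euler0 * euler2\<close> is replaced by \<open>- e25 ^ 2\<close>, only
  \<open>e25 ^ 5\<close> and the products of \<open>e25 ^ (5 - k)\<close> with
  \<open>euler0 ^ k\<close> or \<open>euler2 ^ k\<close> are left. For \<open>0 < k < 5\<close> the
  latter have no exponents divisible by 5.\<close>

lemma hecke_U_euler_product_power:
  defines "C \<equiv> hecke_U (e25 ^ 5)"
  shows "hecke_U (euler_product * e25 ^ 4) = - C"
    and "hecke_U (euler_product ^ 2 * e25 ^ 3) = - C"
    and "hecke_U (euler_product ^ 3 * e25 ^ 2) = 5 * C"
    and "hecke_U (euler_product ^ 4 * e25) = - 5 * C"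
proof -
  note eqs = euler0_euler2 euler_product_dissection
  have euler0: "hecke_U (euler0 * e25 ^ 4) = 0" "hecke_U (euler0 ^ 2 * e25 ^ 3) = 0"
    "hecke_U (euler0 ^ 3 * e25 ^ 2) = 0" "hecke_U (euler0 ^ 4 * e25) = 0"
    using hecke_U_euler0_e25[of 1] hecke_U_euler0_e25[of 2] hecke_U_euler0_e25[of 3] hecke_U_euler0_e25[of 4]
    by simp_all
  have euler2: "hecke_U (euler2 * e25 ^ 4) = 0" "hecke_U (euler2 ^ 2 * e25 ^ 3) = 0"
    "hecke_U (euler2 ^ 3 * e25 ^ 2) = 0" "hecke_U (euler2 ^ 4 * e25) = 0"
    using hecke_U_euler2_e25[of 1] hecke_U_euler2_e25[of 2] hecke_U_euler2_e25[of 3] hecke_U_euler2_e25[of 4]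
    by simp_all
  note U = hecke_U_add hecke_U_diff hecke_U_numeral_mult hecke_U_uminus euler0 euler2 C_def
  have "euler_product * e25 ^ 4 = euler0 * e25 ^ 4 - e25 ^ 5 + euler2 * e25 ^ 4"
    using eqs by algebra
  then show "hecke_U (euler_product * e25 ^ 4) = - C" by (simp only: U) simp
  have "euler_product ^ 2 * e25 ^ 3 = euler0 ^ 2 * e25 ^ 3 - 2 * (euler0 * e25 ^ 4) - e25 ^ 5
      - 2 * (euler2 * e25 ^ 4) + euler2 ^ 2 * e25 ^ 3"
    using eqs by algebra
  then show "hecke_U (euler_product ^ 2 * e25 ^ 3) = - C" by (simp only: U) simp
  have "euler_product ^ 3 * e25 ^ 2 = euler0 ^ 3 * e25 ^ 2 - 3 * (euler0 ^ 2 * e25 ^ 3) + 5 * e25 ^ 5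
      - 3 * (euler2 ^ 2 * e25 ^ 3) + euler2 ^ 3 * e25 ^ 2"
    using eqs by algebra
  then show "hecke_U (euler_product ^ 3 * e25 ^ 2) = 5 * C" by (simp only: U) simp
  have "euler_product ^ 4 * e25 = euler0 ^ 4 * e25 - 4 * (euler0 ^ 3 * e25 ^ 2) + 2 * (euler0 ^ 2 * e25 ^ 3)
      + 8 * (euler0 * e25 ^ 4) - 5 * e25 ^ 5 + 8 * (euler2 * e25 ^ 4) + 2 * (euler2 ^ 2 * e25 ^ 3)
      - 4 * (euler2 ^ 3 * e25 ^ 2) + euler2 ^ 4 * e25"
    using eqs by algebra
  then show "hecke_U (euler_product ^ 4 * e25) = - 5 * C" by (simp only: U) simp
qed

text \<open>Since \<open>Df * dil tf = zf^5\<close>, the series \<open>Af m\<close> is \<open>(dil tf)^2 * zf^(m-10)\<close> without negative powers.\<close>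

definition Af :: "nat \<Rightarrow> int fps" where
  "Af m = fps_right_inverse Df 1 ^ 2 * zf ^ m"

lemma inv_Df: "Df * fps_right_inverse Df 1 = 1"
  by (rule fps_right_inverse) simp

lemma Af_Df: "Df ^ 2 * Af m = zf ^ m"
proof -
  have "Df ^ 2 * Af m = (Df * fps_right_inverse Df 1) ^ 2 * zf ^ m"
    by (simp add: Af_def power_mult_distrib mult_ac)
  then show ?thesis by (simp add: inv_Df)
qed

lemma Af_zf: "Af m * zf ^ k = Af (m + k)"
  by (simp add: Af_def power_add mult_ac)

lemma Af_10: "Af 10 = dil tf ^ 2"
proof -
  have "Df ^ 2 * Af 10 = (zf ^ 5) ^ 2" by (simp add: Af_Df flip: power_mult)
  also have "\<dots> = Df ^ 2 * dil tf ^ 2" unfolding zf_power_5 by algebra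
  finally show ?thesis by simp
qed

lemma Af_rec: "Af (m + 5) = dil tf * (25 * Af (m + 4) + 25 * Af (m + 3) + 15 * Af (m + 2) + 5 * Af (m + 1) + Af m)"
  unfolding Af_zf[of m, symmetric] zf_power_5 Df_def by algebra

text \<open>\<open>Af (10 - j)\<close> is \<open>dil tf ^ 2\<close> over \<open>zf ^ j\<close>, and
  \<open>1 / zf\<close> is \<open>euler_product / e25\<close>. Multiplying by
  \<open>e25 ^ 5\<close>, a series in q^5, clears the denominator inside U.\<close>

lemma hecke_U_Af_aux:
  assumes "hecke_U (euler_product ^ j * e25 ^ (5 - j)) = of_int c * hecke_U (e25 ^ 5)" "j \<le> 5"
  shows "hecke_U (Af (10 - j)) = of_int c * tf ^ 2"
proof -
  define g where "g = fps_X * dil euler_product ^ 5"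
  have g: "e25 ^ 5 = dil g" by (simp add: g_def e25_def dil_simps power_mult_distrib flip: power_mult)
  have U: "hecke_U (dil g) = g" for g :: "int fps"
    using hecke_U_dil_mult[of g 1] by (simp add: fps_eq_iff dil_nth)
  have "dil g * Af (10 - j) = e25 ^ (5 - j) * (euler_product * zf) ^ j * Af (10 - j)"
    using assms(2) by (simp add: g[symmetric] euler_product_zf flip: power_add)
  also have "\<dots> = e25 ^ (5 - j) * euler_product ^ j * (Af (10 - j) * zf ^ j)"
    by (simp add: power_mult_distrib mult_ac)
  also have "Af (10 - j) * zf ^ j = dil (tf ^ 2)"
    using assms(2) by (simp add: Af_zf Af_10 dil_power)
  finally have "dil g * Af (10 - j) = dil (tf ^ 2) * (euler_product ^ j * e25 ^ (5 - j))"
    by (simp add: mult_ac)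
  from arg_cong[OF this, of hecke_U] have "g * hecke_U (Af (10 - j)) = g * (of_int c * tf ^ 2)"
    unfolding hecke_U_dil_mult assms(1) g U by (simp add: mult_ac)
  moreover have "g \<noteq> 0" by (simp add: g_def dil_nonzero)
  ultimately show ?thesis by simp
qed

lemma hecke_U_Af:
  "hecke_U (Af 9) = - (tf ^ 2)" "hecke_U (Af 8) = - (tf ^ 2)"
  "hecke_U (Af 7) = 5 * tf ^ 2" "hecke_U (Af 6) = - 5 * tf ^ 2" "hecke_U (Af 5) = tf"
proof -
  show 9: "hecke_U (Af 9) = - (tf ^ 2)"
    using hecke_U_Af_aux[of 1 "-1"] hecke_U_euler_product_power(1) by simp
  show 8: "hecke_U (Af 8) = - (tf ^ 2)"
    using hecke_U_Af_aux[of 2 "-1"] hecke_U_euler_product_power(2) by simp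
  show 7: "hecke_U (Af 7) = 5 * tf ^ 2"
    using hecke_U_Af_aux[of 3 5] hecke_U_euler_product_power(3) by simp
  show 6: "hecke_U (Af 6) = - 5 * tf ^ 2"
    using hecke_U_Af_aux[of 4 "-5"] hecke_U_euler_product_power(4) by simp
  \<comment> \<open>The value at 10 and the recurrence give the one at 5. Five consecutive indices
    below 10 are needed, because \<open>Bf_eq\<close> says nothing about
    \<open>Bf 10\<close>.\<close>
  have 10: "hecke_U (Af 10) = tf ^ 2"
    using hecke_U_Af_aux[of 0 1] by simp
  have "hecke_U (Af 10) = tf * (25 * hecke_U (Af 9) + 25 * hecke_U (Af 8) + 15 * hecke_U (Af 7) +
    5 * hecke_U (Af 6) + hecke_U (Af 5))"
    using Af_rec[of 5] by (simp add: hecke_U_dil_mult hecke_U_add hecke_U_numeral_mult)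
  then have "tf * hecke_U (Af 5) = tf * tf"
    unfolding 10 9 8 7 6 by algebra
  then show "hecke_U (Af 5) = tf" by simp
qed

lemma fps_XD_Af: "fps_XD (Af m) = Af m * (10 * dil Sf + (of_nat m - 10) * zlog)"
proof -
  have z: "fps_XD (zf ^ k) = zf ^ k * (of_nat k * zlog)" for k
    by (rule fps_XD_power_logarithmic[OF fps_XD_zf])
  have "Af m * zf ^ 10 = Af 10 * zf ^ m" unfolding Af_zf by (simp add: add.commute)
  also have "\<dots> = dil tf ^ 2 * zf ^ m" by (simp add: Af_10)
  finally have eq: "Af m * zf ^ 10 = dil tf ^ 2 * zf ^ m" .
  have "fps_XD (Af m) * zf ^ 10 + Af m * (zf ^ 10 * (10 * zlog)) = fps_XD (Af m * zf ^ 10)"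
    unfolding fps_XD_mult z by simp
  also have "\<dots> = (dil tf ^ 2 * zf ^ m) * (2 * (5 * dil Sf) + of_nat m * zlog)"
    unfolding eq using fps_XD_mult_logarithmic[OF fps_XD_power_logarithmic[OF fps_XD_dil_tf, of 2] z] by simp
  also have "\<dots> = (Af m * zf ^ 10) * (2 * (5 * dil Sf) + of_nat m * zlog)"
    unfolding eq ..
  finally have "zf ^ 10 * fps_XD (Af m) = zf ^ 10 * (Af m * (10 * dil Sf + (of_nat m - 10) * zlog))"
    by algebra
  then show ?thesis by simp
qed

definition Bf :: "nat \<Rightarrow> int fps" where
  "Bf m = hecke_U (Sf * Af m)"

lemma Bf_rec: "Bf (m + 5) = tf * (25 * Bf (m + 4) + 25 * Bf (m + 3) + 15 * Bf (m + 2) + 5 * Bf (m + 1) + Bf m)"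
proof -
  have "Sf * Af (m + 5) = dil tf * (25 * (Sf * Af (m + 4)) + 25 * (Sf * Af (m + 3)) +
      15 * (Sf * Af (m + 2)) + 5 * (Sf * Af (m + 1)) + Sf * Af m)"
    unfolding Af_rec by algebra
  then show ?thesis
    by (simp add: Bf_def hecke_U_dil_mult hecke_U_add hecke_U_numeral_mult)
qed

text \<open>By \<open>fps_XD_Af\<close> and \<open>Sf_eq\<close>,
  \<open>(m - 10) * Sf * Af m\<close> is a combination of the derivative of \<open>Af m\<close> and
  of \<open>5 * dil Sf * Af m\<close>. U gains a 5 on the first and pulls \<open>Sf\<close> out of
  the second.\<close>

lemma Bf_eq:
  assumes "hecke_U (Af m) = of_int c * tf ^ j"
  shows "(of_nat m - 10) * Bf m = 5 * of_int c * (6 * of_nat j - of_nat m - 2) * Sf * tf ^ j"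
proof -
  have "(of_nat m - 10) * (Sf * Af m) = 6 * fps_XD (Af m) - 5 * (of_nat m + 2) * (dil Sf * Af m)"
    unfolding fps_XD_Af using Sf_eq by algebra
  then have "of_int (int m - 10) * (Sf * Af m) = 6 * fps_XD (Af m) - of_int (5 * (int m + 2)) * (dil Sf * Af m)"
    by simp
  from arg_cong[OF this, of hecke_U]
  have "of_int (int m - 10) * Bf m = 6 * (5 * fps_XD (hecke_U (Af m))) - of_int (5 * (int m + 2)) * (Sf * hecke_U (Af m))"
    unfolding Bf_def hecke_U_diff hecke_U_of_int_mult hecke_U_numeral_mult hecke_U_dil_mult hecke_U_fps_XD .
  moreover have "fps_XD (hecke_U (Af m)) = of_int c * (tf ^ j * (of_nat j * Sf))"
    unfolding assms fps_XD_mult fps_XD_power_logarithmic[OF fps_XD_tf] by simp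
  ultimately show ?thesis
    unfolding assms by (simp add: algebra_simps)
qed

lemma Bf_values:
  "Bf 5 = Sf * tf" "Bf 6 = Sf * (25 * tf ^ 2)" "Bf 7 = Sf * (- 25 * tf ^ 2)"
  "Bf 8 = Sf * (5 * tf ^ 2)" "Bf 9 = Sf * (5 * tf ^ 2)"
  "Bf 4 = Sf * (125 * tf ^ 2)" "Bf 3 = Sf * (- 10 * tf - 625 * tf ^ 2)" "Bf 2 = Sf * (625 * tf ^ 2)"
  "Bf 1 = Sf * (150 * tf + 3125 * tf ^ 2)" "Bf 0 = Sf * (1 - 500 * tf - 12500 * tf ^ 2)"
proof -
  have cancel: "x = y" if "k * x = k * y" "k \<noteq> 0" for k x y :: "int fps"
    using that by simp
  have "-5 * Bf 5 = -5 * (Sf * tf)"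
    using Bf_eq[of 5 1 1] hecke_U_Af(5) by (simp add: mult_ac)
  then show 5: "Bf 5 = Sf * tf" by (rule cancel) simp
  have "-4 * Bf 6 = -4 * (Sf * (25 * tf ^ 2))"
    using Bf_eq[of 6 "-5" 2] hecke_U_Af(4) by (simp add: mult_ac)
  then show 6: "Bf 6 = Sf * (25 * tf ^ 2)" by (rule cancel) simp
  have "-3 * Bf 7 = -3 * (Sf * (- 25 * tf ^ 2))"
    using Bf_eq[of 7 5 2] hecke_U_Af(3) by (simp add: mult_ac)
  then show 7: "Bf 7 = Sf * (- 25 * tf ^ 2)" by (rule cancel) simp
  have "-2 * Bf 8 = -2 * (Sf * (5 * tf ^ 2))"
    using Bf_eq[of 8 "-1" 2] hecke_U_Af(2) by (simp add: mult_ac)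
  then show 8: "Bf 8 = Sf * (5 * tf ^ 2)" by (rule cancel) simp
  have "-1 * Bf 9 = -1 * (Sf * (5 * tf ^ 2))"
    using Bf_eq[of 9 "-1" 2] hecke_U_Af(1) by (simp add: mult_ac)
  then show 9: "Bf 9 = Sf * (5 * tf ^ 2)" by (rule cancel) simp
  \<comment> \<open>From here the recurrence is run backwards: it is solved for its lowest term and
    \<open>tf\<close> is cancelled.\<close>
  have "tf * Bf 4 = tf * (Sf * (125 * tf ^ 2))"
    using Bf_rec[of 4, simplified] unfolding 9 8 7 6 5 by algebra
  then show 4: "Bf 4 = Sf * (125 * tf ^ 2)" by (rule cancel) simp
  have "tf * Bf 3 = tf * (Sf * (- 10 * tf - 625 * tf ^ 2))"
    using Bf_rec[of 3, simplified] unfolding 8 7 6 5 4 by algebra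
  then show 3: "Bf 3 = Sf * (- 10 * tf - 625 * tf ^ 2)" by (rule cancel) simp
  have "tf * Bf 2 = tf * (Sf * (625 * tf ^ 2))"
    using Bf_rec[of 2, simplified] unfolding 7 6 5 4 3 by algebra
  then show 2: "Bf 2 = Sf * (625 * tf ^ 2)" by (rule cancel) simp
  have r: "Bf 6 = tf * (25 * Bf 5 + 25 * Bf 4 + 15 * Bf 3 + 5 * Bf 2 + Bf 1)"
    using Bf_rec[of 1] by (simp add: eval_nat_numeral)
  have "tf * Bf 1 = tf * (Sf * (150 * tf + 3125 * tf ^ 2))"
    using r unfolding 6 5 4 3 2 by algebra
  then show 1: "Bf 1 = Sf * (150 * tf + 3125 * tf ^ 2)" by (rule cancel) simp
  have "tf * Bf 0 = tf * (Sf * (1 - 500 * tf - 12500 * tf ^ 2))"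
    using Bf_rec[of 0, simplified add_0_left] unfolding 5 4 3 2 1 by algebra
  then show "Bf 0 = Sf * (1 - 500 * tf - 12500 * tf ^ 2)" by (rule cancel) simp
qed

subsection \<open>5-adic estimates\<close>

text \<open>
  \<open>tpoly c d\<close> consists of the integer polynomials in \<open>tf\<close> whose coefficient of \<open>tf^j\<close> vanishes for
  \<open>j < d\<close> and is divisible by \<open>5\<close> to the power \<open>\<lfloor>(5j + c) / 2\<rfloor>\<close>.
\<close>

inductive_set tpoly :: "int \<Rightarrow> nat \<Rightarrow> int fps set" for c :: int and d :: nat where
  zero: "0 \<in> tpoly c d"
| add: "f \<in> tpoly c d \<Longrightarrow> d \<le> j \<Longrightarrow> 5 * int j + c \<le> 2 * int e + 1 \<Longrightarrow>
    of_int x * 5 ^ e * tf ^ j + f \<in> tpoly c d"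

lemma tpoly_monom:
  "d \<le> j \<Longrightarrow> 5 * int j + c \<le> 2 * int e + 1 \<Longrightarrow> of_int x * 5 ^ e * tf ^ j \<in> tpoly c d"
  using tpoly.add[OF tpoly.zero, of d j c e x] by simp

lemma tpoly_add: "f \<in> tpoly c d \<Longrightarrow> g \<in> tpoly c d \<Longrightarrow> f + g \<in> tpoly c d"
  by (induction rule: tpoly.induct) (simp_all add: add.assoc tpoly.add)

lemma tpoly_mono: "f \<in> tpoly c d \<Longrightarrow> c' \<le> c \<Longrightarrow> d' \<le> d \<Longrightarrow> f \<in> tpoly c' d'"
  by (induction rule: tpoly.induct) (auto intro!: tpoly.intros)

lemma tpoly_mult_monom:
  assumes "f \<in> tpoly c d"
  shows "of_int y * 5 ^ k * tf ^ i * f \<in> tpoly (c + 2 * int k - 5 * int i) (d + i)"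
  using assms
proof (induction rule: tpoly.induct)
  case (add f j e x)
  have "of_int (x * y) * 5 ^ (e + k) * tf ^ (j + i) + of_int y * 5 ^ k * tf ^ i * f
      \<in> tpoly (c + 2 * int k - 5 * int i) (d + i)"
    by (rule tpoly.add) (use add in auto)
  then show ?case by (simp add: power_add algebra_simps)
qed (simp add: tpoly.zero)

lemma tpoly_divide:
  assumes "f \<in> tpoly c d" "i \<le> d"
  obtains g where "g \<in> tpoly (c + 5 * int i) (d - i)" "f = tf ^ i * g"
proof -
  from assms(1) have "\<exists>g \<in> tpoly (c + 5 * int i) (d - i). f = tf ^ i * g"
  proof (induction rule: tpoly.induct)
    case (add f j e x)
    then obtain g where g: "g \<in> tpoly (c + 5 * int i) (d - i)" "f = tf ^ i * g" by auto
    have "of_int x * 5 ^ e * tf ^ (j - i) + g \<in> tpoly (c + 5 * int i) (d - i)"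
      by (rule tpoly.add) (use add g assms(2) in \<open>auto simp: of_nat_diff\<close>)
    moreover have "tf ^ j = tf ^ i * tf ^ (j - i)"
      using add assms(2) by (simp flip: power_add)
    ultimately show ?case
      by (intro bexI[of _ "of_int x * 5 ^ e * tf ^ (j - i) + g"]) (simp_all add: g algebra_simps)
  qed (auto intro: tpoly.zero)
  then show ?thesis using that by auto
qed

lemma tpoly_dvd:
  assumes "f \<in> tpoly c d" "2 * int k \<le> 5 * int d + c"
  shows "5 ^ k dvd f"
  using assms
proof (induction rule: tpoly.induct)
  case (add f j e x)
  then have "k \<le> e" by simp
  then have "(5 :: int fps) ^ k dvd 5 ^ e" by (rule le_imp_power_dvd)
  with add show ?case by (intro dvd_add) (auto intro: dvd_mult dvd_mult2)
qed simp

text \<open>The weight \<open>1 - m\<close> is what the recurrence preserves: the factor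
  \<open>tf\<close> costs 5, while the coefficients 25, 25, 15, 5, 1 of \<open>Bf (k + 4)\<close>
  down to \<open>Bf k\<close> contain \<open>5 ^ e\<close> with \<open>2 * e\<close> at least the
  offset 4, 3, 2, 1, 0.\<close>

lemma Bf_tpoly: "\<exists>f \<in> tpoly (1 - int m) ((m + 4) div 5). Bf m = Sf * f"
proof (induction m rule: less_induct)
  case (less m)
  have mon: "g \<in> tpoly c d" if "g = of_int x * 5 ^ e * tf ^ j" "d \<le> j" "5 * int j + c \<le> 2 * int e + 1"
    for g c d x e j
    using tpoly_monom[OF that(2,3)] that(1) by simp
  have "m = 0 \<or> m = 1 \<or> m = 2 \<or> m = 3 \<or> m = 4 \<or> m = (m - 5) + 5" by linarith
  then consider "m = 0" | "m = 1" | "m = 2" | "m = 3" | "m = 4" | k where "m = k + 5" by blast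
  then show ?case
  proof cases
    case 1
    have "1 + (- 500 * tf + - 12500 * tf ^ 2) \<in> tpoly 1 0"
      by (intro tpoly_add mon[of _ 1 0 0] mon[of _ "-4" 3 1] mon[of _ "-4" 5 2]) simp_all
    then show ?thesis using 1 Bf_values(10) by (intro bexI[of _ "1 + (- 500 * tf + - 12500 * tf ^ 2)"]) simp_all
  next
    case 2
    have "150 * tf + 3125 * tf ^ 2 \<in> tpoly 0 1"
      by (intro tpoly_add mon[of _ 6 2 1] mon[of _ 1 5 2]) simp_all
    then show ?thesis using 2 Bf_values(9) by (intro bexI[of _ "150 * tf + 3125 * tf ^ 2"]) simp_all
  next
    case 3
    have "625 * tf ^ 2 \<in> tpoly (-1) 1"
      by (intro mon[of _ 1 4 2]) simp_all
    then show ?thesis using 3 Bf_values(8) by (intro bexI[of _ "625 * tf ^ 2"]) simp_all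
  next
    case 4
    have "- 10 * tf + - 625 * tf ^ 2 \<in> tpoly (-2) 1"
      by (intro tpoly_add mon[of _ "-2" 1 1] mon[of _ "-1" 4 2]) simp_all
    then show ?thesis using 4 Bf_values(7) by (intro bexI[of _ "- 10 * tf + - 625 * tf ^ 2"]) simp_all
  next
    case 5
    have "125 * tf ^ 2 \<in> tpoly (-3) 1"
      by (intro mon[of _ 1 3 2]) simp_all
    then show ?thesis using 5 Bf_values(6) by (intro bexI[of _ "125 * tf ^ 2"]) simp_all
  next
    case 6
    define c d where "c = 1 - int m" and "d = (m + 4) div 5"
    have step: "\<exists>g \<in> tpoly c d. tf * (of_int x * 5 ^ e * Bf (k + i)) = Sf * g"
      if "i \<le> 2 * e" "i < 5" for i e x
    proof -
      from less.IH[of "k + i"] that 6 obtain f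
        where f: "f \<in> tpoly (1 - int (k + i)) ((k + i + 4) div 5)" "Bf (k + i) = Sf * f"
        by auto
      have "of_int x * 5 ^ e * tf ^ 1 * f \<in> tpoly (1 - int (k + i) + 2 * int e - 5 * int 1) ((k + i + 4) div 5 + 1)"
        by (rule tpoly_mult_monom) (rule f)
      then have "of_int x * 5 ^ e * tf ^ 1 * f \<in> tpoly c d"
        by (rule tpoly_mono) (use that 6 in \<open>auto simp: c_def d_def\<close>)
      then show ?thesis using f(2) by (intro bexI[of _ "of_int x * 5 ^ e * tf ^ 1 * f"]) (simp_all add: mult_ac)
    qed
    obtain g4 g3 g2 g1 g0 where g: "g4 \<in> tpoly c d" "g3 \<in> tpoly c d" "g2 \<in> tpoly c d" "g1 \<in> tpoly c d" "g0 \<in> tpoly c d"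
      and eq: "tf * (25 * Bf (k + 4)) = Sf * g4" "tf * (25 * Bf (k + 3)) = Sf * g3"
        "tf * (15 * Bf (k + 2)) = Sf * g2" "tf * (5 * Bf (k + 1)) = Sf * g1" "tf * Bf k = Sf * g0"
      using step[of 4 2 1] step[of 3 2 1] step[of 2 1 3] step[of 1 1 1] step[of 0 0 1] by auto
    have "Bf m = Sf * (g4 + g3 + g2 + g1 + g0)"
      unfolding 6 Bf_rec distrib_left eq by simp
    moreover have "g4 + g3 + g2 + g1 + g0 \<in> tpoly c d"
      by (intro tpoly_add g)
    ultimately show ?thesis unfolding c_def d_def by blast
  qed
qed

text \<open>Multiplied by \<open>dil (tf ^ i)\<close>, the argument becomes
  \<open>dil (af ^ 2)\<close> times \<open>Sf * Af (6 * i + s)\<close>, the square of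
  \<open>1 / Df\<close> in \<open>Af\<close> coming from \<open>af = dil af / Df\<close>. After
  division by \<open>tf ^ i\<close> a factor \<open>tf\<close> is left, because
  \<open>(6 * i + s + 4) div 5\<close> exceeds \<open>i\<close> when \<open>i + s\<close> is
  positive.\<close>

lemma hecke_U_monom:
  assumes "1 \<le> i + s"
  obtains f where "f \<in> tpoly (1 - int i - int s) 1" "hecke_U (Sf * af ^ 2 * zf ^ s * tf ^ i) = Sf * af ^ 2 * f"
proof -
  have a: "af = dil af * fps_right_inverse Df 1"
    using af_Df inv_Df by (metis mult.assoc mult_1_right)
  have "dil (tf ^ i) * (Sf * af ^ 2 * zf ^ s * tf ^ i) = Sf * af ^ 2 * zf ^ s * (tf * dil tf) ^ i"
    by (simp add: dil_power power_mult_distrib mult_ac)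
  also have "\<dots> = Sf * af ^ 2 * zf ^ (6 * i + s)"
    unfolding tf_dil_tf power_add power_mult by (simp only: mult_ac)
  also have "\<dots> = dil (af ^ 2) * (Sf * Af (6 * i + s))"
    unfolding Af_def dil_power by (subst a) (simp add: power_mult_distrib mult_ac)
  finally have "hecke_U (dil (tf ^ i) * (Sf * af ^ 2 * zf ^ s * tf ^ i)) = hecke_U (dil (af ^ 2) * (Sf * Af (6 * i + s)))"
    by (rule arg_cong)
  then have eq: "tf ^ i * hecke_U (Sf * af ^ 2 * zf ^ s * tf ^ i) = af ^ 2 * Bf (6 * i + s)"
    unfolding hecke_U_dil_mult Bf_def .
  obtain f where f: "f \<in> tpoly (1 - int (6 * i + s)) ((6 * i + s + 4) div 5)" "Bf (6 * i + s) = Sf * f"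
    using Bf_tpoly by blast
  have d: "i + 1 \<le> (6 * i + s + 4) div 5" using assms by linarith
  then obtain g where g: "g \<in> tpoly (1 - int (6 * i + s) + 5 * int i) ((6 * i + s + 4) div 5 - i)" "f = tf ^ i * g"
    using tpoly_divide[OF f(1), of i] by auto
  have "g \<in> tpoly (1 - int i - int s) 1"
    by (rule tpoly_mono[OF g(1)]) (use d in auto)
  moreover have "tf ^ i * hecke_U (Sf * af ^ 2 * zf ^ s * tf ^ i) = tf ^ i * (Sf * af ^ 2 * g)"
    unfolding eq f(2) g(2) by (simp add: mult_ac)
  then have "hecke_U (Sf * af ^ 2 * zf ^ s * tf ^ i) = Sf * af ^ 2 * g"
    by simp
  ultimately show ?thesis by (rule that)
qed

text \<open>Raising \<open>c\<close> by 4 is the gain of \<open>5^2\<close>. A term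
  \<open>5 ^ e * tf ^ j\<close> goes to weight \<open>1 - j - s + 2e\<close>, which is at least
  \<open>c + 4j - s\<close>.\<close>

lemma hecke_U_tpoly:
  assumes "f \<in> tpoly (4 * int k - 5) 1" "s \<le> 1"
  shows "\<exists>g \<in> tpoly (4 * int (Suc k) - 5) 1. hecke_U (Sf * af ^ 2 * zf ^ s * f) = Sf * af ^ 2 * g"
  using assms(1)
proof (induction rule: tpoly.induct)
  case (add f j e x)
  obtain g where g: "g \<in> tpoly (4 * int (Suc k) - 5) 1" "hecke_U (Sf * af ^ 2 * zf ^ s * f) = Sf * af ^ 2 * g"
    using add.IH by blast
  obtain h where h: "h \<in> tpoly (1 - int j - int s) 1" "hecke_U (Sf * af ^ 2 * zf ^ s * tf ^ j) = Sf * af ^ 2 * h"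
    using hecke_U_monom[of j s] add by auto
  have "of_int x * 5 ^ e * tf ^ 0 * h \<in> tpoly (1 - int j - int s + 2 * int e - 5 * int 0) (1 + 0)"
    by (rule tpoly_mult_monom) (rule h)
  then have h': "of_int x * 5 ^ e * h \<in> tpoly (4 * int (Suc k) - 5) 1"
  proof -
    have "4 * int (Suc k) - 5 \<le> 1 - int j - int s + 2 * int e"
    \<comment> \<open>For \<open>j = 1\<close> the bound is \<open>4k <= 2e + 1\<close>, hence
      \<open>4k <= 2e\<close> by parity; this recovers the unit lost when \<open>s = 1\<close>. For
      larger \<open>j\<close> there is room to spare.\<close>
    proof (cases "j = 1")
      case True
      then show ?thesis using add assms(2) by auto presburger
    next
      case False
      then show ?thesis using add assms(2) by auto
    qed
    then show ?thesis
      using tpoly_mono[of "of_int x * 5 ^ e * tf ^ 0 * h" "1 - int j - int s + 2 * int e - 5 * int 0" "1 + 0"]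
        \<open>of_int x * 5 ^ e * tf ^ 0 * h \<in> _\<close> by simp
  qed
  have "Sf * af ^ 2 * zf ^ s * (of_int x * 5 ^ e * tf ^ j + f) =
    of_int (x * 5 ^ e) * (Sf * af ^ 2 * zf ^ s * tf ^ j) + Sf * af ^ 2 * zf ^ s * f"
    by (simp add: algebra_simps)
  then have "hecke_U (Sf * af ^ 2 * zf ^ s * (of_int x * 5 ^ e * tf ^ j + f)) =
    of_int (x * 5 ^ e) * (Sf * af ^ 2 * h) + Sf * af ^ 2 * g"
    by (simp only: hecke_U_add hecke_U_of_int_mult h(2) g(2))
  also have "\<dots> = Sf * af ^ 2 * (of_int x * 5 ^ e * h + g)"
    by (simp add: algebra_simps)
  finally have "hecke_U (Sf * af ^ 2 * zf ^ s * (of_int x * 5 ^ e * tf ^ j + f)) = \<dots>" .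
  then show ?case using tpoly_add[OF h' g(1)] by blast
qed (auto intro!: bexI[of _ 0] tpoly.zero)

text \<open>The weight \<open>-1\<close> is \<open>4 * 1 - 5\<close>. The factor \<open>zf\<close>
  makes \<open>hecke_U_monom\<close> applicable to the constant term in \<open>tf\<close>; the
  others bring \<open>500 = 4 * 5^3\<close> and \<open>15625 = 5^6\<close>.\<close>

lemma hecke_U_zf_E6: "\<exists>f \<in> tpoly (-1) 1. hecke_U (zf * E6_fps) = Sf * af ^ 2 * f"
proof -
  obtain f0 where f0: "f0 \<in> tpoly (1 - int 0 - int 1) 1" "hecke_U (Sf * af ^ 2 * zf ^ 1 * tf ^ 0) = Sf * af ^ 2 * f0"
    by (rule hecke_U_monom[of 0 1]) auto
  obtain f1 where f1: "f1 \<in> tpoly (1 - int 1 - int 1) 1" "hecke_U (Sf * af ^ 2 * zf ^ 1 * tf ^ 1) = Sf * af ^ 2 * f1"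
    by (rule hecke_U_monom[of 1 1]) auto
  obtain f2 where f2: "f2 \<in> tpoly (1 - int 2 - int 1) 1" "hecke_U (Sf * af ^ 2 * zf ^ 1 * tf ^ 2) = Sf * af ^ 2 * f2"
    by (rule hecke_U_monom[of 2 1]) auto
  have "zf * E6_fps = Sf * af ^ 2 * zf ^ 1 * tf ^ 0 - 500 * (Sf * af ^ 2 * zf ^ 1 * tf ^ 1)
    - 15625 * (Sf * af ^ 2 * zf ^ 1 * tf ^ 2)"
    unfolding E6_fps_eq by (simp add: algebra_simps)
  then have "hecke_U (zf * E6_fps) = Sf * af ^ 2 * f0 - 500 * (Sf * af ^ 2 * f1) - 15625 * (Sf * af ^ 2 * f2)"
    by (simp only: hecke_U_diff hecke_U_numeral_mult f0(2) f1(2) f2(2))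
  also have "\<dots> = Sf * af ^ 2 * (f0 + (of_int (-4) * 5 ^ 3 * tf ^ 0 * f1 + of_int (-1) * 5 ^ 6 * tf ^ 0 * f2))"
    by (simp add: algebra_simps)
  finally have "hecke_U (zf * E6_fps) = \<dots>" .
  moreover have "f0 + (of_int (-4) * 5 ^ 3 * tf ^ 0 * f1 + of_int (-1) * 5 ^ 6 * tf ^ 0 * f2) \<in> tpoly (-1) 1"
  proof (intro tpoly_add)
    show "f0 \<in> tpoly (-1) 1" by (rule tpoly_mono[OF f0(1)]) auto
    show "of_int (-4) * 5 ^ 3 * tf ^ 0 * f1 \<in> tpoly (-1) 1"
      by (rule tpoly_mono[OF tpoly_mult_monom[OF f1(1)]]) auto
    show "of_int (-1) * 5 ^ 6 * tf ^ 0 * f2 \<in> tpoly (-1) 1"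
      by (rule tpoly_mono[OF tpoly_mult_monom[OF f2(1)]]) auto
  qed
  ultimately show ?thesis by blast
qed

section \<open>The arithmetic progressions and the induction on \<open>k\<close>\<close>

text \<open>Since \<open>5^2 = 1\<close> modulo 24, the residue of \<open>-1 / 5^k\<close> is 19 for
  odd \<open>k\<close> and 23 for even \<open>k\<close>.\<close>

lemma delta_5:
  assumes "1 \<le> k"
  shows "24 * delta 5 k = (if odd k then 19 else 23) * 5 ^ k + 1"
proof -
  have "24 dvd (if odd k then 19 else 23) * 5 ^ k + (1::nat)"
  proof (cases "odd k")
    case True
    then obtain m where k: "k = 2 * m + 1" by (elim oddE)
    have "[(5::nat) ^ (2 * m) = 1 ^ m] (mod 24)"
      unfolding power_mult by (rule cong_pow) (simp add: cong_def)
    then have "[19 * 5 * (5::nat) ^ (2 * m) + 1 = 19 * 5 * 1 ^ m + 1] (mod 24)"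
      by (intro cong_add cong_mult) auto
    then have "[19 * 5 * (5::nat) ^ (2 * m) + 1 = 0] (mod 24)"
      by (simp add: cong_def)
    with True k show ?thesis by (simp add: cong_0_iff mult_ac)
  next
    case False
    then obtain m where k: "k = 2 * m" by auto
    have "[(5::nat) ^ (2 * m) = 1 ^ m] (mod 24)"
      unfolding power_mult by (rule cong_pow) (simp add: cong_def)
    then have "[23 * (5::nat) ^ (2 * m) + 1 = 23 * 1 ^ m + 1] (mod 24)"
      by (intro cong_add cong_mult) auto
    then have "[23 * (5::nat) ^ (2 * m) + 1 = 0] (mod 24)"
      by (simp add: cong_def)
    with False k show ?thesis by (simp add: cong_0_iff)
  qed
  then obtain d where d: "24 * d = (if odd k then 19 else 23) * 5 ^ k + (1::nat)" by (metis dvdE)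
  have "(5::nat) ^ 1 \<le> 5 ^ k" using assms by (intro power_increasing) auto
  then have "0 < d" "d < 5 ^ k" using d by (auto split: if_splits)
  moreover have "[24 * d = 1] (mod 5 ^ k)"
  proof -
    have "[(if odd k then 19 else 23) * 5 ^ k + 1 = 0 + (1::nat)] (mod 5 ^ k)"
      by (intro cong_add) (auto simp: cong_0_iff)
    then show ?thesis unfolding d by simp
  qed
  moreover have "prime (5::nat)" by simp
  ultimately have "delta 5 k = d"
    unfolding delta_def using delta_exists_unique[of 5 k] assms by (intro the1_equality) auto
  with d show ?thesis by simp
qed

lemma delta_5_Suc:
  assumes "1 \<le> k"
  shows "delta 5 (Suc k) = 5 ^ k * (if odd k then 4 else 3) + delta 5 k"
  using delta_5[OF assms] delta_5[of "Suc k"] by (auto split: if_splits)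

definition section_fps :: "nat \<Rightarrow> int fps" where
  "section_fps k = Abs_fps (\<lambda>n. e6 (5 ^ k * n + delta 5 k))"

text \<open>Passing to \<open>k + 1\<close> adds the 5-adic digit 4 or 3 to \<open>delta\<close>.
  The shift by q or q^2 aligns this digit with the multiples of 5, as
  \<open>5n - 1 = 5 (n - 1) + 4\<close> and \<open>5n - 2 = 5 (n - 1) + 3\<close>.\<close>

lemma hecke_U_section:
  assumes "1 \<le> k"
  shows "hecke_U (fps_X ^ (if odd k then 1 else 2) * section_fps k) = fps_X * section_fps (Suc k)"
proof (rule fps_ext)
  fix n
  show "hecke_U (fps_X ^ (if odd k then 1 else 2) * section_fps k) $ n = (fps_X * section_fps (Suc k)) $ n"
  proof (cases n)
    case (Suc m)
    have "5 ^ k * (5 * m + (if odd k then 4 else 3)) + delta 5 k = 5 ^ Suc k * m + delta 5 (Suc k)"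
      unfolding delta_5_Suc[OF assms] by (simp add: algebra_simps)
    moreover have "5 * n - (if odd k then 1 else 2) = 5 * m + (if odd k then 4 else 3)"
      using Suc by auto
    ultimately show ?thesis
      using Suc by (simp add: fps_X_power_mult_nth section_fps_def)
  qed (simp add: fps_X_power_mult_nth)
qed

lemma e25_zf: "zf * euler_product = fps_X * dil (dil euler_product)"
  using euler_product_zf by (simp add: e25_def mult.commute)

lemma section_fps_tpoly:
  assumes "1 \<le> k"
  shows "\<exists>f \<in> tpoly (4 * int k - 5) 1.
    fps_X * section_fps k * (if odd k then dil euler_product else euler_product) = Sf * af ^ 2 * f"
  using assms
proof (induction k rule: nat_induct_at_least)
  case base
  have "zf * E6_fps = dil (dil euler_product) * (fps_X * e6_fps)"
    unfolding e6_fps_mult_euler_product[symmetric] using e25_zf by algebra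
  moreover have "hecke_U (fps_X * e6_fps) = fps_X * section_fps 1"
  proof (rule fps_ext)
    fix n
    have "delta 5 1 = 4" using delta_5[of 1] by simp
    then show "hecke_U (fps_X * e6_fps) $ n = (fps_X * section_fps 1) $ n"
      by (cases n) (simp_all add: section_fps_def e6_def add.commute)
  qed
  ultimately have "hecke_U (zf * E6_fps) = fps_X * section_fps 1 * dil euler_product"
    by (simp only: hecke_U_dil_mult) (simp add: mult_ac)
  then show ?case using hecke_U_zf_E6 by simp
next
  case (Suc k)
  then obtain f where f: "f \<in> tpoly (4 * int k - 5) 1"
    "fps_X * section_fps k * (if odd k then dil euler_product else euler_product) = Sf * af ^ 2 * f"
    by blast
  \<comment> \<open>For odd \<open>k\<close> the factor E(q^5) can leave U at once. For even
    \<open>k\<close> the factor E(q) must first be exchanged for \<open>q E(q^25)\<close> by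
    \<open>zf\<close>, which also supplies the second q of the shift.\<close>
  define s where "s = (if odd k then 0 else 1 :: nat)"
  have "s \<le> 1" by (simp add: s_def)
  obtain g where g: "g \<in> tpoly (4 * int (Suc k) - 5) 1" "hecke_U (Sf * af ^ 2 * zf ^ s * f) = Sf * af ^ 2 * g"
    using hecke_U_tpoly[OF f(1) \<open>s \<le> 1\<close>] by blast
  have "Sf * af ^ 2 * zf ^ s * f = zf ^ s * (fps_X * section_fps k * (if odd k then dil euler_product else euler_product))"
    unfolding f(2) by (simp add: mult_ac)
  also have "\<dots> = dil (if odd k then euler_product else dil euler_product) *
      (fps_X ^ (if odd k then 1 else 2) * section_fps k)"
    using e25_zf by (simp add: s_def power2_eq_square mult_ac)
  finally have "Sf * af ^ 2 * g = hecke_U \<dots>" using g(2) by simp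
  also have "\<dots> = fps_X * section_fps (Suc k) * (if odd (Suc k) then dil euler_product else euler_product)"
    unfolding hecke_U_dil_mult hecke_U_section[OF Suc.hyps] by (simp add: mult_ac)
  finally show ?case using g(1) by (intro bexI[of _ g]) simp_all
qed

theorem theorem4p12:
  fixes k n :: nat
  assumes "1 \<le> k"
  shows "[e6 (5 ^ k * n + delta 5 k) = 0] (mod 5 ^ (2 * k))"
proof -
  define u where "u = (if odd k then dil euler_product else euler_product)"
  \<comment> \<open>The inverse of \<open>u\<close> has integer coefficients, so divisibility
    survives the removal of \<open>u\<close>.\<close>
  define v where "v = (if odd k then dil inv_euler else inv_euler)"
  have uv: "u * v = 1" using inv_euler dil_inv_euler by (simp add: u_def v_def)
  obtain f where f: "f \<in> tpoly (4 * int k - 5) 1" "fps_X * section_fps k * u = Sf * af ^ 2 * f"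
    using section_fps_tpoly[OF assms] unfolding u_def by blast
  \<comment> \<open>All exponents of \<open>tf\<close> are at least 1, where the weight
    \<open>5 + (4k - 5) = 4k\<close> means \<open>5^(2k)\<close>.\<close>
  have "5 ^ (2 * k) dvd f" by (rule tpoly_dvd[OF f(1)]) auto
  then have "5 ^ (2 * k) dvd Sf * af ^ 2 * f * v" by simp
  also have "Sf * af ^ 2 * f * v = fps_X * section_fps k"
    unfolding f(2)[symmetric] using uv by (simp add: mult.assoc)
  finally obtain h where h: "fps_X * section_fps k = 5 ^ (2 * k) * h" by (elim dvdE)
  have "(5 :: int fps) ^ (2 * k) = fps_const (5 ^ (2 * k))"
    by (simp only: numeral_fps_const fps_const_power)
  with h have "fps_X * section_fps k = fps_const (5 ^ (2 * k)) * h" by (simp only:)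
  then have "(fps_X * section_fps k) $ Suc n = (fps_const (5 ^ (2 * k)) * h) $ Suc n" by (rule arg_cong)
  then have "section_fps k $ n = 5 ^ (2 * k) * h $ Suc n"
    unfolding fps_mult_left_const_nth by simp
  then show ?thesis by (simp add: section_fps_def cong_0_iff)
qed

end
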